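(* Let $d$ be a positive integer. If $\tau\in\mathbb{T}^d$ is a carapoint for $\varphi\in\mathcal{SA}_d$, then $\varphi$ is directionally differentiable at $\tau$.
   Context: $\mathbb{D}$ is the open unit disc, $\mathbb{T}$ the unit circle, $\|\lambda\|_\infty=\max_j|\lambda_j|$ on $\mathbb{C}^d$. Schur-Agler class: $\mathcal{SA}_d$ is the set of analytic $\varphi:\mathbb{D}^d\to\mathbb{C}$ such that $\sup_{0<r<1}\|\varphi(rT_1,\dots,rT_d)\|\le 1$ for every commuting $d$-tuple $(T_1,\dots,T_d)$ of contractions on any complex Hilbert space. $\tau$ is a carapoint for $\varphi$ if $\liminf_{\lambda\to\tau,\lambda\in\mathbb{D}^d}\frac{1-|\varphi(\lambda)|}{1-\|\lambda\|_\infty}<\infty$. Non-tangential limits: a set $S\subseteq\mathbb{D}^d$ with $\tau\in\overline{S}$ approaches $\tau$ non-tangentially if there is $c>0$ with $\|\lambda-\tau\|_\infty\le c(1-\|\lambda\|_\infty)$ for all $\lambda\in S$. If $\tau$ is a carapoint for $\varphi\in\mathcal{SA}_d$ then the limit of $\varphi(\lambda)$ as $\lambda\to\tau$, $\lambda\in S$, exists for every such $S$, is independent of $S$ and has modulus $1$; it is denoted by $\varphi(\tau)$. Let $\mathbb{C}^d_+(\tau)=\{z\in\mathbb{C}^d:\mathrm{Re}(z_j\overline{\tau_j})>0,\ j=1,\dots,d\}$. $\varphi$ is directionally differentiable at a carapoint $\tau\in\mathbb{T}^d$ if, whenever $-\delta\in\mathbb{C}^d_+(\tau)$, the limit $\lim_{t\to0^+}\frac{\varphi(\tau+t\delta)-\varphi(\tau)}{t}$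 exists. *)

theory Defs
  imports "HOL-Analysis.Analysis" "HOL-Algebra.Module"
begin

section \<open>Complex Hilbert spaces\<close>

text \<open>
  Hilbert spaces are given by a carrier set with operations rather than by a type class, so that
  it is possible to quantify over all of them (within a given ambient type) inside a formula.
\<close>

definition complex_field :: "complex ring" where
  "complex_field = \<lparr>carrier = UNIV, mult = (*), one = 1, zero = 0, add = (+)\<rparr>"

text \<open>
  The ring multiplication and unit that a module record inherits carry no meaning here.
\<close>

record 'v inner_module = "(complex, 'v) module" +
  ip :: "'v \<Rightarrow> 'v \<Rightarrow> complex"

definition hnorm :: "'v inner_module \<Rightarrow> 'v \<Rightarrow> real" where
  "hnorm H x = sqrt (Re (ip H x x))"

locale complex_hilbert_space = module complex_field H for H :: "'v inner_module" +
  assumes ip_add: "\<lbrakk>x \<in> carrier H; y \<in> carrier H; z \<in> carrier H\<rbrakk> \<Longrightarrow>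
      ip H (x \<oplus>\<^bsub>H\<^esub> y) z = ip H x z + ip H y z"
    and ip_smult: "\<lbrakk>x \<in> carrier H; y \<in> carrier H\<rbrakk> \<Longrightarrow> ip H (a \<odot>\<^bsub>H\<^esub> x) y = a * ip H x y"
    and ip_commute: "\<lbrakk>x \<in> carrier H; y \<in> carrier H\<rbrakk> \<Longrightarrow> ip H y x = cnj (ip H x y)"
    and ip_pos: "\<lbrakk>x \<in> carrier H; x \<noteq> \<zero>\<^bsub>H\<^esub>\<rbrakk> \<Longrightarrow> 0 < Re (ip H x x)"
    and complete: "\<lbrakk>\<And>n. X n \<in> carrier H;
        \<And>e. 0 < e \<Longrightarrow> \<exists>N. \<forall>m\<ge>N. \<forall>n\<ge>N. hnorm H (X m \<ominus>\<^bsub>H\<^esub> X n) < e\<rbrakk>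
      \<Longrightarrow> \<exists>x\<in>carrier H. (\<lambda>n. hnorm H (X n \<ominus>\<^bsub>H\<^esub> x)) \<longlonglongrightarrow> 0"

definition linear_operator :: "'v inner_module \<Rightarrow> ('v \<Rightarrow> 'v) \<Rightarrow> bool" where
  "linear_operator H A \<longleftrightarrow> A \<in> carrier H \<rightarrow> carrier H \<and>
     (\<forall>x\<in>carrier H. \<forall>y\<in>carrier H. A (x \<oplus>\<^bsub>H\<^esub> y) = A x \<oplus>\<^bsub>H\<^esub> A y) \<and>
     (\<forall>a. \<forall>x\<in>carrier H. A (a \<odot>\<^bsub>H\<^esub> x) = a \<odot>\<^bsub>H\<^esub> A x)"

definition opnorm_le :: "'v inner_module \<Rightarrow> ('v \<Rightarrow> 'v) \<Rightarrow> real \<Rightarrow> bool" where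
  "opnorm_le H A C \<longleftrightarrow> (\<forall>x\<in>carrier H. hnorm H (A x) \<le> C * hnorm H x)"

definition contraction :: "'v inner_module \<Rightarrow> ('v \<Rightarrow> 'v) \<Rightarrow> bool" where
  "contraction H A \<longleftrightarrow> linear_operator H A \<and> opnorm_le H A 1"

definition commuting_contractions :: "'v inner_module \<Rightarrow> ('d \<Rightarrow> 'v \<Rightarrow> 'v) \<Rightarrow> bool" where
  "commuting_contractions H T \<longleftrightarrow> (\<forall>j. contraction H (T j)) \<and>
     (\<forall>i j. \<forall>x\<in>carrier H. T i (T j x) = T j (T i x))"


section \<open>Analytic functions on the polydisc and their functional calculus\<close>

definition norm_inf :: "complex ^ 'd \<Rightarrow> real" where
  "norm_inf z = (MAX j. cmod (z $ j))"

definition polydisc :: "(complex ^ 'd) set" where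
  "polydisc = {z. \<forall>j. cmod (z $ j) < 1}"

definition torus :: "(complex ^ 'd) set" where
  "torus = {z. \<forall>j. cmod (z $ j) = 1}"

text \<open>
  On an open set, analytic means complex differentiable at every point: the (Frechet) derivative
  exists and is complex linear.
\<close>

definition analytic_in :: "(complex ^ 'd \<Rightarrow> complex) \<Rightarrow> (complex ^ 'd) set \<Rightarrow> bool" where
  "analytic_in f U \<longleftrightarrow> (\<forall>z\<in>U. \<exists>D. (f has_derivative D) (at z) \<and> (\<forall>a w. D (a *s w) = a * D w))"

definition power_series_of :: "(complex ^ 'd \<Rightarrow> complex) \<Rightarrow> (('d \<Rightarrow> nat) \<Rightarrow> complex) \<Rightarrow> bool" where
  "power_series_of f c \<longleftrightarrow>
     (\<forall>z\<in>polydisc. ((\<lambda>\<alpha>. c \<alpha> * (\<Prod>j\<in>UNIV. z $ j ^ \<alpha> j)) has_sum f z) UNIV)"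

text \<open>
  The product of the powers \<open>T j ^^ \<alpha> j\<close>, taken along some enumeration of the indices;
  for a commuting tuple the enumeration does not matter.
\<close>

definition op_monomial :: "('d::finite \<Rightarrow> 'v \<Rightarrow> 'v) \<Rightarrow> ('d \<Rightarrow> nat) \<Rightarrow> 'v \<Rightarrow> 'v" where
  "op_monomial T \<alpha> = foldr (\<lambda>j A. (T j ^^ \<alpha> j) \<circ> A) (SOME js. set js = UNIV \<and> distinct js) id"

text \<open>
  \<open>has_value_at H f T A\<close> says that \<open>A = f(T)\<close>: the power series of \<open>f\<close>, evaluated at the
  tuple \<open>T\<close>, converges unconditionally to \<open>A\<close> in operator norm.  The coefficients are unique,
  and \<open>A\<close> is unique on the carrier.  For \<open>f\<close> analytic on the polydisc and commuting
  operators of norm at most some \<open>r < 1\<close> such an \<open>A\<close> always exists.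
\<close>

definition has_value_at ::
    "'v inner_module \<Rightarrow> (complex ^ 'd \<Rightarrow> complex) \<Rightarrow> ('d \<Rightarrow> 'v \<Rightarrow> 'v) \<Rightarrow> ('v \<Rightarrow> 'v) \<Rightarrow> bool" where
  "has_value_at H f T A \<longleftrightarrow> linear_operator H A \<and>
     (\<exists>c. power_series_of f c \<and>
       (\<forall>e>0. \<exists>F\<^sub>0. finite F\<^sub>0 \<and> (\<forall>F. finite F \<and> F\<^sub>0 \<subseteq> F \<longrightarrow>
          opnorm_le H (\<lambda>x. A x \<ominus>\<^bsub>H\<^esub> (\<Oplus>\<^bsub>H\<^esub>\<alpha>\<in>F. c \<alpha> \<odot>\<^bsub>H\<^esub> op_monomial T \<alpha> x)) e)))"

text \<open>
  The carriers of the Hilbert spaces range over all subsets of \<open>'i \<Rightarrow> complex\<close>, with arbitrary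
  operations.  Every Hilbert space is isomorphic to one of these if \<open>'i\<close> is large enough, since
  it is isomorphic to \<open>\<ell>\<^sup>2('i)\<close> for an orthonormal basis indexed by \<open>'i\<close>.  The choice of \<open>'i\<close>
  does not affect the class: whatever \<open>'i\<close> is, the type \<open>'i \<Rightarrow> complex\<close> has at least the
  cardinality of the continuum, so all separable spaces occur up to isomorphism, and the norm of
  \<open>f(rT)\<close> on any space is the supremum of its norms on the separable subspaces invariant
  under \<open>T\<close>.
\<close>

definition schur_agler :: "'i itself \<Rightarrow> (complex ^ 'd \<Rightarrow> complex) set" where
  "schur_agler _ = {f. analytic_in f polydisc \<and>
     (\<forall>(H :: ('i \<Rightarrow> complex) inner_module) T.
        complex_hilbert_space H \<and> commuting_contractions H T \<longrightarrow>
        (\<forall>r. 0 < r \<and> r < 1 \<longrightarrow>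
           (\<exists>A. has_value_at H f (\<lambda>j x. complex_of_real r \<odot>\<^bsub>H\<^esub> T j x) A \<and> opnorm_le H A 1)))}"


section \<open>Boundary behaviour\<close>

definition carapoint :: "(complex ^ 'd \<Rightarrow> complex) \<Rightarrow> complex ^ 'd \<Rightarrow> bool" where
  "carapoint f \<tau> \<longleftrightarrow>
     Liminf (at \<tau> within polydisc) (\<lambda>z. ereal ((1 - cmod (f z)) / (1 - norm_inf z))) < \<infinity>"

definition approaches_nontangentially :: "(complex ^ 'd) set \<Rightarrow> complex ^ 'd \<Rightarrow> bool" where
  "approaches_nontangentially S \<tau> \<longleftrightarrow> S \<subseteq> polydisc \<and> \<tau> \<in> closure S \<and>
     (\<exists>c>0. \<forall>z\<in>S. norm_inf (z - \<tau>) \<le> c * (1 - norm_inf z))"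

definition has_nontangential_limit ::
    "(complex ^ 'd \<Rightarrow> complex) \<Rightarrow> complex ^ 'd \<Rightarrow> complex \<Rightarrow> bool" where
  "has_nontangential_limit f \<tau> w \<longleftrightarrow>
     (\<forall>S. approaches_nontangentially S \<tau> \<longrightarrow> (f \<longlongrightarrow> w) (at \<tau> within S))"

text \<open>
  The value \<open>f(\<tau>)\<close> at a boundary point; the value that the total function \<open>f\<close> happens to take
  at \<open>\<tau>\<close> is irrelevant.
\<close>

definition boundary_value :: "(complex ^ 'd \<Rightarrow> complex) \<Rightarrow> complex ^ 'd \<Rightarrow> complex" where
  "boundary_value f \<tau> = (THE w. has_nontangential_limit f \<tau> w)"

definition half_plane_product :: "complex ^ 'd \<Rightarrow> (complex ^ 'd) set" where
  "half_plane_product \<tau> = {z. \<forall>j. 0 < Re (z $ j * cnj (\<tau> $ j))}"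

definition directionally_differentiable ::
    "(complex ^ 'd \<Rightarrow> complex) \<Rightarrow> complex ^ 'd \<Rightarrow> bool" where
  "directionally_differentiable f \<tau> \<longleftrightarrow>
     (\<forall>\<delta>. - \<delta> \<in> half_plane_product \<tau> \<longrightarrow>
        (\<exists>L. ((\<lambda>t. (f (\<tau> + t *\<^sub>R \<delta>) - boundary_value f \<tau>) / complex_of_real t) \<longlongrightarrow> L)
               (at_right 0)))"

end

theory Submission
  imports Defs "HOL-Complex_Analysis.Riemann_Mapping"
begin

text \<open>
  Write \<open>w\<close> for the boundary value.  The functional calculus on a one-dimensional Hilbert space shows that
  \<open>|\<phi>| \<le> 1\<close> on the polydisc (\<open>schur_agler_norm_le_1\<close>), and the argument continues with the Schwarz-Pick
  inequality for such functions.

  Letting one of the two points in Schwarz-Pick tend to the carapoint yields a Julia inequality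
  (\<open>carapoint_imp_julia_point\<close>).  Near \<open>\<tau>\<close> it bounds \<open>\<phi> - w\<close> linearly by the distance from \<open>\<tau>\<close> on non-tangential
  sets (\<open>dist_boundary_value_le\<close>).  Hence \<open>w\<close> is the non-tangential limit, and the difference quotients
  \<open>(\<phi> (\<tau> + t \<delta>) - w) / t\<close> form a locally bounded family of holomorphic functions of \<open>\<delta>\<close>.

  If all \<open>- \<delta> $ j * cnj (\<tau> $ j)\<close> are positive reals, the difference quotient is that of a function of one complex
  variable, and its convergence is the Julia-Caratheodory theorem, used here in the form that a
  holomorphic function of nonnegative real part on the right half-plane satisfies \<open>G x / x \<longlongrightarrow> c\<close>
  (\<open>half_plane_angular_derivative_at_infinity\<close>).  For the other directions there is in general no analytic
  disc in the polydisc tangent to them.  Instead each of them lies on a complex line whose real points, near the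
  base point, are real directions, and a Vitali argument on that line extends the convergence (\<open>Vitali_at_right\<close>).
\<close>

section \<open>Functions in the Schur-Agler class are bounded by one\<close>

text \<open>
  A one-dimensional Hilbert space must live on a subset of \<open>'i \<Rightarrow> complex\<close>.  The constant functions are
  used: they form a copy of the complex numbers for every \<open>'i\<close>, and their value at any index, here
  \<open>undefined\<close>, recovers the scalar.
\<close>

definition complex_line :: "('i \<Rightarrow> complex) inner_module" where
  "complex_line = \<lparr>carrier = range (\<lambda>c _. c), mult = (\<lambda>x y i. x i * y i), one = (\<lambda>_. 1),
     zero = (\<lambda>_. 0), add = (\<lambda>x y i. x i + y i), smult = (\<lambda>a x i. a * x i),
     ip = (\<lambda>x y. x undefined * cnj (y undefined))\<rparr>"

lemma complex_line_simps:
  "carrier complex_line = range (\<lambda>c _. c)"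
  "zero complex_line = (\<lambda>_. 0)"
  "add complex_line = (\<lambda>x y i. x i + y i)"
  "smult complex_line = (\<lambda>a x i. a * x i)"
  "ip complex_line = (\<lambda>x y. x undefined * cnj (y undefined))"
  by (simp_all add: complex_line_def)

lemma hnorm_complex_line: "hnorm complex_line x = cmod (x undefined)"
  by (simp add: hnorm_def complex_line_simps complex_mult_cnj cmod_def power2_eq_square)

lemma cring_complex_field: "cring complex_field"
proof (rule cringI)
  show "abelian_group complex_field"
    by (rule abelian_groupI)
      (auto simp: complex_field_def algebra_simps intro: exI[of _ "- x" for x] add.right_inverse)
  show "Group.comm_monoid complex_field"
    by (rule comm_monoidI) (auto simp: complex_field_def algebra_simps)
qed (auto simp: complex_field_def algebra_simps)

lemma abelian_group_complex_line: "abelian_group (complex_line :: ('i \<Rightarrow> complex) inner_module)"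
proof (rule abelian_groupI)
  fix x :: "'i \<Rightarrow> complex"
  assume "x \<in> carrier complex_line"
  then show "\<exists>y\<in>carrier complex_line. y \<oplus>\<^bsub>complex_line\<^esub> x = \<zero>\<^bsub>complex_line\<^esub>"
    by (intro bexI[of _ "\<lambda>i. - x i"]) (auto simp: complex_line_simps)
qed (auto simp: complex_line_simps algebra_simps)

lemma minus_complex_line:
  assumes "x \<in> carrier complex_line" "y \<in> carrier complex_line"
  shows "x \<ominus>\<^bsub>complex_line\<^esub> y = (\<lambda>i. x i - y i)"
proof -
  interpret abelian_group complex_line by (rule abelian_group_complex_line)
  have "\<ominus>\<^bsub>complex_line\<^esub> y = (\<lambda>i. - y i)"
    using assms by (intro minus_equality) (auto simp: complex_line_simps)
  then show ?thesis by (simp add: a_minus_def complex_line_simps)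
qed

lemma finsum_complex_line:
  assumes "finite F"
  shows "(\<Oplus>\<^bsub>complex_line\<^esub>k\<in>F. (\<lambda>i. g k)) = (\<lambda>i. \<Sum>k\<in>F. g k)"
  using assms
proof (induction F)
  case empty
  interpret abelian_group complex_line by (rule abelian_group_complex_line)
  show ?case by (simp add: complex_line_simps)
next
  case (insert k F)
  interpret abelian_group complex_line by (rule abelian_group_complex_line)
  have "(\<lambda>k i. g k) \<in> F \<rightarrow> carrier complex_line" "(\<lambda>i. g k) \<in> carrier complex_line"
    by (auto simp: complex_line_simps)
  then show ?case using insert by (simp add: complex_line_simps)
qed

lemma complex_hilbert_space_complex_line:
  "complex_hilbert_space (complex_line :: ('i \<Rightarrow> complex) inner_module)"
proof -
  have "module complex_field (complex_line :: ('i \<Rightarrow> complex) inner_module)"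
    by (intro moduleI cring_complex_field abelian_group_complex_line)
      (auto simp: complex_field_def complex_line_simps algebra_simps)
  moreover have "\<exists>x\<in>carrier complex_line. (\<lambda>n. hnorm complex_line (X n \<ominus>\<^bsub>complex_line\<^esub> x)) \<longlonglongrightarrow> 0"
    if X: "\<And>n. X n \<in> carrier complex_line"
      and cau: "\<And>e. 0 < e \<Longrightarrow>
        \<exists>N. \<forall>m\<ge>N. \<forall>n\<ge>N. hnorm complex_line (X m \<ominus>\<^bsub>complex_line\<^esub> X n) < e"
    for X :: "nat \<Rightarrow> 'i \<Rightarrow> complex"
  proof -
    have "Cauchy (\<lambda>n. X n undefined)"
      using cau X by (auto simp: Cauchy_def dist_norm minus_complex_line hnorm_complex_line)
    then obtain c where c: "(\<lambda>n. X n undefined) \<longlonglongrightarrow> c"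
      using Cauchy_convergent convergent_def by blast
    have "(\<lambda>n. hnorm complex_line (X n \<ominus>\<^bsub>complex_line\<^esub> (\<lambda>_. c))) \<longlonglongrightarrow> 0"
      using c X tendsto_norm[OF LIM_zero[OF c]]
      by (simp add: minus_complex_line hnorm_complex_line complex_line_simps)
    then show ?thesis by (auto simp: complex_line_simps)
  qed
  ultimately show ?thesis
    by (intro complex_hilbert_space.intro complex_hilbert_space_axioms.intro)
      (auto simp: complex_line_simps algebra_simps complex_norm_square[symmetric] simp flip: of_real_power)
qed

lemma op_monomial_scalar:
  "op_monomial (\<lambda>j x i. m j * x i) \<alpha> x = (\<lambda>i. (\<Prod>j\<in>UNIV. m j ^ \<alpha> j) * x i)"
  for m :: "'d::finite \<Rightarrow> complex"
proof -
  have pow: "((\<lambda>x i. b * x i) ^^ k) x = (\<lambda>i. b ^ k * x i)" for b :: complex and k and x :: "'i \<Rightarrow> complex"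
    by (induction k) (auto simp: algebra_simps)
  have fold: "foldr (\<lambda>j A. ((\<lambda>x i. m j * x i) ^^ \<alpha> j) \<circ> A) js id x
      = (\<lambda>i. (\<Prod>j\<in>set js. m j ^ \<alpha> j) * x i)"
    if "distinct js" for js and x :: "'i \<Rightarrow> complex"
    using that by (induction js) (auto simp: pow mult.assoc)
  have "\<exists>js. set js = (UNIV :: 'd set) \<and> distinct js"
    by (rule finite_distinct_list) simp
  from someI_ex[OF this] show ?thesis
    unfolding op_monomial_def by (simp add: fold)
qed

text \<open>
  Contractions of a one-dimensional space are multiplications by scalars of modulus at most one, and
  they commute.  For them \<open>op_monomial\<close> is an ordinary monomial, so the operator power series is the
  scalar one and \<open>f(rT)\<close> is multiplication by a value of \<open>f\<close>.
\<close>

lemma schur_agler_norm_le_1: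
  fixes f :: "complex ^ 'd \<Rightarrow> complex"
  assumes f: "f \<in> schur_agler TYPE('i)" and z: "z \<in> polydisc"
  shows "cmod (f z) \<le> 1"
proof -
  \<comment> \<open>Every point of the polydisc has the form \<open>r\<close> times a point of the closed polydisc.\<close>
  have "\<exists>r<1. 0 < r \<and> (\<forall>j. cmod (z $ j) \<le> r)"
  proof -
    have "Max (insert 0 (range (\<lambda>j. cmod (z $ j)))) < 1"
      using z by (auto simp: polydisc_def)
    from dense[OF this] obtain r where r: "Max (insert 0 (range (\<lambda>j. cmod (z $ j)))) < r" "r < 1"
      by auto
    then show ?thesis by (auto intro!: exI[of _ r] less_imp_le)
  qed
  then obtain r where r: "0 < r" "r < 1" "\<And>j. cmod (z $ j) \<le> r" by auto
  define H :: "('i \<Rightarrow> complex) inner_module" where "H = complex_line"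
  define T where "T = (\<lambda>j (x :: 'i \<Rightarrow> complex) i. (z $ j / r) * x i)"
  have "cmod x * cmod (z $ j) \<le> r * cmod x" for x j
    using mult_left_mono[OF r(3)[of j], of "cmod x"] by (simp add: mult.commute)
  then have "commuting_contractions H T"
    using r
    by (auto simp: commuting_contractions_def contraction_def linear_operator_def opnorm_le_def
        H_def T_def complex_line_simps hnorm_complex_line algebra_simps norm_mult norm_divide
        divide_simps mult_right_mono)
  then obtain A where A: "has_value_at H f (\<lambda>j x. complex_of_real r \<odot>\<^bsub>H\<^esub> T j x) A" "opnorm_le H A 1"
    using f r complex_hilbert_space_complex_line unfolding schur_agler_def H_def by blast
  have rT: "(\<lambda>j x. complex_of_real r \<odot>\<^bsub>H\<^esub> T j x) = (\<lambda>j x i. z $ j * x i)"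
    using r by (simp add: H_def T_def complex_line_simps)
  define u :: "'i \<Rightarrow> complex" where "u = (\<lambda>_. 1)"
  have u: "u \<in> carrier complex_line" by (auto simp: u_def complex_line_simps)
  from A(1) obtain c where lin: "linear_operator H A" and c: "power_series_of f c"
    and lim: "\<And>e. e > 0 \<Longrightarrow> \<exists>F0. finite F0 \<and> (\<forall>F. finite F \<and> F0 \<subseteq> F \<longrightarrow>
       opnorm_le H (\<lambda>x. A x \<ominus>\<^bsub>H\<^esub> (\<Oplus>\<^bsub>H\<^esub>\<alpha>\<in>F. c \<alpha> \<odot>\<^bsub>H\<^esub> op_monomial (\<lambda>j x i. z $ j * x i) \<alpha> x)) e)"
    unfolding has_value_at_def rT by blast
  define s where "s = (\<lambda>\<alpha>. c \<alpha> * (\<Prod>j\<in>UNIV. z $ j ^ \<alpha> j))"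
  have Au: "A u \<in> carrier complex_line"
    using lin u by (auto simp: linear_operator_def H_def)
  have est: "cmod (A u undefined - sum s F) \<le> e"
    if F: "finite F" and op: "opnorm_le H (\<lambda>x. A x \<ominus>\<^bsub>H\<^esub>
      (\<Oplus>\<^bsub>H\<^esub>\<alpha>\<in>F. c \<alpha> \<odot>\<^bsub>H\<^esub> op_monomial (\<lambda>j x i. z $ j * x i) \<alpha> x)) e" for F e
  proof -
    have "(\<Oplus>\<^bsub>H\<^esub>\<alpha>\<in>F. c \<alpha> \<odot>\<^bsub>H\<^esub> op_monomial (\<lambda>j x i. z $ j * x i) \<alpha> u) = (\<lambda>i::'i. sum s F)"
      using F by (simp add: op_monomial_scalar H_def u_def complex_line_simps(4) finsum_complex_line s_def)
    moreover have "(\<lambda>i::'i. sum s F) \<in> carrier complex_line" by (auto simp: complex_line_simps)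
    moreover have "hnorm H (A u \<ominus>\<^bsub>H\<^esub>
        (\<Oplus>\<^bsub>H\<^esub>\<alpha>\<in>F. c \<alpha> \<odot>\<^bsub>H\<^esub> op_monomial (\<lambda>j x i. z $ j * x i) \<alpha> u)) \<le> e * hnorm H u"
      using op u by (simp only: opnorm_le_def H_def)
    moreover have "hnorm H u = 1" by (simp add: H_def hnorm_complex_line u_def)
    ultimately show ?thesis
      using Au by (simp add: H_def minus_complex_line hnorm_complex_line)
  qed
  have "(s has_sum A u undefined) UNIV"
    unfolding has_sum_def tendsto_iff
  proof (intro allI impI)
    fix e :: real assume "e > 0"
    then obtain F0 where F0: "finite F0" "\<And>F. finite F \<Longrightarrow> F0 \<subseteq> F \<Longrightarrow>
       opnorm_le H (\<lambda>x. A x \<ominus>\<^bsub>H\<^esub> (\<Oplus>\<^bsub>H\<^esub>\<alpha>\<in>F. c \<alpha> \<odot>\<^bsub>H\<^esub> op_monomial (\<lambda>j x i. z $ j * x i) \<alpha> x)) (e/2)"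
      using lim[of "e/2"] by auto
    have "dist (sum s F) (A u undefined) < e" if "finite F" "F0 \<subseteq> F" for F
      using est[OF that(1) F0(2)[OF that]] \<open>e > 0\<close> by (simp add: dist_norm norm_minus_commute)
    then show "\<forall>\<^sub>F F in finite_subsets_at_top UNIV. dist (sum s F) (A u undefined) < e"
      using F0(1) by (auto simp: eventually_finite_subsets_at_top)
  qed
  moreover have "(s has_sum f z) UNIV"
    using c z by (simp add: power_series_of_def s_def)
  ultimately have "f z = A u undefined" by (rule has_sum_unique[OF _ , rotated])
  also have "cmod (A u undefined) \<le> 1"
    using A(2) u by (auto simp: opnorm_le_def H_def hnorm_complex_line u_def)
  finally show ?thesis .
qed

section \<open>Schwarz-Pick inequalities\<close>

definition schur_class :: "(complex ^ 'd \<Rightarrow> complex) set" where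
  "schur_class = {f. analytic_in f polydisc \<and> (\<forall>z\<in>polydisc. cmod (f z) \<le> 1)}"

lemma analytic_in_compose_holomorphic:
  fixes f :: "complex ^ 'd \<Rightarrow> complex" and \<gamma> :: "complex \<Rightarrow> complex ^ 'd"
  assumes f: "analytic_in f U" and S: "open S" and \<gamma>U: "\<And>z. z \<in> S \<Longrightarrow> \<gamma> z \<in> U"
    and \<gamma>: "\<And>j. (\<lambda>z. \<gamma> z $ j) holomorphic_on S"
  shows "(\<lambda>z. f (\<gamma> z)) holomorphic_on S"
proof (subst holomorphic_on_open[OF S], intro ballI)
  fix z assume z: "z \<in> S"
  define v where "v = (\<chi> j. deriv (\<lambda>z. \<gamma> z $ j) z)"
  have comp: "((\<lambda>z. \<gamma> z $ j) has_derivative (\<lambda>h. h * v $ j)) (at z)" for j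
    using holomorphic_derivI[OF \<gamma> S z] by (simp add: v_def has_field_derivative_def mult.commute[of _ "deriv _ _"])
  have "(\<gamma> has_derivative (\<lambda>h. h *s v)) (at z)"
    unfolding has_derivative_componentwise_within[of \<gamma>]
    by (auto simp: Basis_vec_def inner_axis intro!: has_derivative_inner_left comp)
  moreover obtain D where D: "(f has_derivative D) (at (\<gamma> z))" "\<And>a w. D (a *s w) = a * D w"
    using f \<gamma>U[OF z] unfolding analytic_in_def by blast
  ultimately have "((\<lambda>z. f (\<gamma> z)) has_derivative (\<lambda>h. D (h *s v))) (at z)"
    using has_derivative_compose by blast
  moreover have "(\<lambda>h. D (h *s v)) = (*) (D v)" by (simp add: D(2) mult.commute fun_eq_iff)
  ultimately show "\<exists>f'. ((\<lambda>z. f (\<gamma> z)) has_field_derivative f') (at z)"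
    by (auto simp: has_field_derivative_def)
qed

text \<open>
  After division by the first term both sides are one minus the squared pseudo-hyperbolic distance of
  \<open>a\<close> and \<open>c\<close>.
\<close>

lemma pseudo_hyperbolic_identity:
  "(cmod (1 - a * cnj c))\<^sup>2 - (cmod (a - c))\<^sup>2 = (1 - (cmod a)\<^sup>2) * (1 - (cmod c)\<^sup>2)"
  unfolding cmod_power2 by (simp add: power2_eq_square algebra_simps)

lemma one_minus_mult_cnj_nonzero:
  assumes "cmod a \<le> 1" "cmod c < 1"
  shows "1 - a * cnj c \<noteq> 0"
proof
  assume "1 - a * cnj c = 0"
  then have "1 = cmod a * cmod c"
    by (metis complex_mod_cnj norm_mult norm_one right_minus_eq)
  also have "\<dots> \<le> cmod c" using assms(1) by (simp add: mult_left_le_one_le)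
  finally show False using assms(2) by simp
qed

text \<open>
  Composing with the disc automorphism that takes \<open>f 0\<close> to the origin reduces this to the Schwarz
  lemma, provided the values of \<open>f\<close> stay in the open disc.  Values of modulus one are reached by
  applying that case to \<open>q f\<close> and letting \<open>q\<close> increase to one; for this reason the inequality is
  stated without denominators.
\<close>

lemma Schwarz_Pick_origin:
  assumes hol: "f holomorphic_on ball 0 1" and bd: "\<And>z. z \<in> ball 0 1 \<Longrightarrow> cmod (f z) \<le> 1"
    and z: "cmod z < 1"
  shows "(1 - (cmod z)\<^sup>2) * (cmod (1 - f z * cnj (f 0)))\<^sup>2 \<le> (1 - (cmod (f z))\<^sup>2) * (1 - (cmod (f 0))\<^sup>2)"
proof -
  have strict: "(1 - (cmod z)\<^sup>2) * (cmod (1 - g z * cnj (g 0)))\<^sup>2 \<le> (1 - (cmod (g z))\<^sup>2) * (1 - (cmod (g 0))\<^sup>2)"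
    if holg: "g holomorphic_on ball 0 1" and bdg: "\<And>z. cmod z < 1 \<Longrightarrow> cmod (g z) < 1" for g
  proof -
    define c where "c = g 0"
    have c: "cmod c < 1" by (simp add: c_def bdg)
    define h where "h = Moebius_function 0 c \<circ> g"
    have "h holomorphic_on ball 0 1"
      unfolding h_def using bdg
      by (intro holomorphic_on_compose_gen[OF holg Moebius_function_holomorphic[OF c]]) auto
    moreover have "h 0 = 0" by (simp add: h_def c_def Moebius_function_eq_zero)
    moreover have "cmod (h z) < 1" if "cmod z < 1" for z
      using Moebius_function_norm_lt_1[OF c bdg[OF that]] by (simp add: h_def)
    ultimately have "cmod (h z) \<le> cmod z" by (rule Schwarz_Lemma) (use z in auto)
    moreover have ne: "1 - g z * cnj c \<noteq> 0"
      using one_minus_mult_cnj_nonzero[of "g z" c] bdg[OF z] c by simp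
    ultimately have "cmod (g z - c) \<le> cmod z * cmod (1 - g z * cnj c)"
      by (simp add: h_def Moebius_function_simple norm_divide divide_le_eq mult.commute split: if_splits)
    then have "(cmod (g z - c))\<^sup>2 \<le> (cmod z)\<^sup>2 * (cmod (1 - g z * cnj c))\<^sup>2"
      by (metis norm_ge_zero power_mono power_mult_distrib)
    then show ?thesis
      using pseudo_hyperbolic_identity[of "g z" c] by (simp add: c_def algebra_simps)
  qed
  define L R where "L = (\<lambda>q::real. (1 - (cmod z)\<^sup>2) * (cmod (1 - (q * f z) * cnj (q * f 0)))\<^sup>2)"
    and "R = (\<lambda>q::real. (1 - (cmod (q * f z))\<^sup>2) * (1 - (cmod (q * f 0))\<^sup>2))"
  have LR: "L q \<le> R q" if "0 < q" "q < 1" for q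
  proof -
    have "cmod (q * f z) < 1" if "cmod z < 1" for z
    proof -
      have "q * cmod (f z) \<le> q" using bd[of z] that \<open>0 < q\<close> mult_left_mono[of "cmod (f z)" 1 q] by simp
      then have "q * cmod (f z) < 1" using \<open>q < 1\<close> by linarith
      then show ?thesis using \<open>0 < q\<close> by (simp add: norm_mult)
    qed
    then show ?thesis
      using strict[of "\<lambda>z. q * f z"] hol unfolding L_def R_def by (simp add: holomorphic_intros)
  qed
  have "(L \<longlongrightarrow> L 1) (at_left 1)" "(R \<longlongrightarrow> R 1) (at_left 1)"
    unfolding L_def R_def by (auto intro!: tendsto_eq_intros)
  moreover have "\<forall>\<^sub>F q in at_left 1. L q \<le> R q"
    using eventually_at_left_real[OF zero_less_one] by eventually_elim (auto intro: LR)
  ultimately have "L 1 \<le> R 1" by (intro tendsto_le[of "at_left 1" R "R 1" L "L 1"]) auto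
  then show ?thesis by (simp add: L_def R_def)
qed

text \<open>
  Two points of the polydisc lie on an analytic disc whose coordinates are Moebius maps composed with
  contractions of the disc.  The coordinate \<open>j\<close> with the largest pseudo-hyperbolic distance governs the
  position of the second point on it, and it is the one for which the inequality holds.
\<close>

lemma Schwarz_Pick_polydisc:
  fixes f :: "complex ^ 'd \<Rightarrow> complex"
  assumes f: "f \<in> schur_class" and l: "l \<in> polydisc" and m: "m \<in> polydisc"
  shows "\<exists>j. (1 - (cmod (l $ j))\<^sup>2) * (1 - (cmod (m $ j))\<^sup>2) * (cmod (1 - f l * cnj (f m)))\<^sup>2
     \<le> (1 - (cmod (f l))\<^sup>2) * (1 - (cmod (f m))\<^sup>2) * (cmod (1 - l $ j * cnj (m $ j)))\<^sup>2"
proof -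
  have lj: "cmod (l $ j) < 1" and mj: "cmod (m $ j) < 1" for j
    using l m by (auto simp: polydisc_def)
  define \<nu> where "\<nu> = (\<lambda>j. Moebius_function 0 (m $ j) (l $ j))"
  define r where "r = Max (range (\<lambda>j. cmod (\<nu> j)))"
  have "r \<in> range (\<lambda>j. cmod (\<nu> j))" unfolding r_def by (rule Max_in) auto
  then obtain j where j: "r = cmod (\<nu> j)" by auto
  have \<nu>r: "cmod (\<nu> i) \<le> r" for i unfolding r_def by (rule Max_ge) auto
  have r1: "r < 1" and r0: "0 \<le> r"
    using Moebius_function_norm_lt_1[OF mj lj] by (simp_all add: j \<nu>_def)
  \<comment> \<open>The disc passes through \<open>m\<close> at \<open>0\<close> and through \<open>l\<close> at \<open>r\<close>.  If \<open>r = 0\<close>, then all \<open>\<nu> i\<close> vanish and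
    the convention \<open>x / 0 = 0\<close> makes the disc constant.\<close>
  define \<gamma> where "\<gamma> = (\<lambda>z. \<chi> i. Moebius_function 0 (- m $ i) (z * (\<nu> i / r)))"
  have inball: "z * (\<nu> i / r) \<in> ball 0 1" if "z \<in> ball 0 1" for z i
  proof -
    have "cmod (\<nu> i / r) \<le> 1" using \<nu>r[of i] r0 by (auto simp: norm_divide divide_le_eq_1)
    then have "cmod z * cmod (\<nu> i / r) \<le> cmod z" by (simp add: mult_left_le)
    then show ?thesis using that unfolding mem_ball_0 norm_mult by linarith
  qed
  have \<gamma>disc: "\<gamma> z \<in> polydisc" if "z \<in> ball 0 1" for z
    using inball[OF that] mj by (auto simp: \<gamma>_def polydisc_def intro!: Moebius_function_norm_lt_1)
  have hol: "(\<lambda>z. f (\<gamma> z)) holomorphic_on ball 0 1"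
  proof (rule analytic_in_compose_holomorphic)
    show "analytic_in f polydisc" using f by (simp add: schur_class_def)
    show "(\<lambda>z. \<gamma> z $ i) holomorphic_on ball 0 1" for i
      unfolding \<gamma>_def vec_lambda_beta
      using mj inball
      by (intro holomorphic_on_compose_gen[OF _ Moebius_function_holomorphic, unfolded o_def] holomorphic_intros) auto
  qed (use \<gamma>disc in auto)
  have \<gamma>bd: "cmod (f (\<gamma> z)) \<le> 1" if "z \<in> ball 0 1" for z
    using f \<gamma>disc[OF that] by (simp add: schur_class_def)
  have \<gamma>0: "\<gamma> 0 = m" by (simp add: \<gamma>_def Moebius_function_of_zero vec_eq_iff)
  have "complex_of_real r * (\<nu> i / r) = \<nu> i" for i using \<nu>r[of i] by (cases "r = 0") auto
  then have \<gamma>r: "\<gamma> (of_real r) = l"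
    using lj mj by (simp add: \<gamma>_def \<nu>_def vec_eq_iff Moebius_function_compose)
  have SP: "(1 - r\<^sup>2) * (cmod (1 - f l * cnj (f m)))\<^sup>2 \<le> (1 - (cmod (f l))\<^sup>2) * (1 - (cmod (f m))\<^sup>2)"
    using Schwarz_Pick_origin[OF hol \<gamma>bd, of "of_real r"] r0 r1 by (simp add: \<gamma>0 \<gamma>r)
  have ne: "1 - l $ j * cnj (m $ j) \<noteq> 0"
    using one_minus_mult_cnj_nonzero[of "l $ j" "m $ j"] lj[of j] mj[of j] by simp
  have "r * cmod (1 - l $ j * cnj (m $ j)) = cmod (l $ j - m $ j)"
    using ne by (simp add: j \<nu>_def Moebius_function_simple norm_divide mult.commute)
  then have "r\<^sup>2 * (cmod (1 - l $ j * cnj (m $ j)))\<^sup>2 = (cmod (l $ j - m $ j))\<^sup>2"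
    by (metis power_mult_distrib)
  then have "(1 - (cmod (l $ j))\<^sup>2) * (1 - (cmod (m $ j))\<^sup>2) = (1 - r\<^sup>2) * (cmod (1 - l $ j * cnj (m $ j)))\<^sup>2"
    using pseudo_hyperbolic_identity[of "l $ j" "m $ j"] by (simp add: algebra_simps)
  then have "(1 - (cmod (l $ j))\<^sup>2) * (1 - (cmod (m $ j))\<^sup>2) * (cmod (1 - f l * cnj (f m)))\<^sup>2
      = ((1 - r\<^sup>2) * (cmod (1 - f l * cnj (f m)))\<^sup>2) * (cmod (1 - l $ j * cnj (m $ j)))\<^sup>2"
    by simp
  also have "\<dots> \<le> (1 - (cmod (f l))\<^sup>2) * (1 - (cmod (f m))\<^sup>2) * (cmod (1 - l $ j * cnj (m $ j)))\<^sup>2"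
    by (rule mult_right_mono[OF SP]) simp
  finally show ?thesis ..
qed

text \<open>
  The inequality at the origin of the disc is transported by a Moebius map \<open>X\<close> from the disc to the half-plane
  with \<open>X 0 = y\<close> and by the Cayley transform \<open>C\<close> of the values.
\<close>

lemma Schwarz_Pick_half_plane:
  assumes hol: "G holomorphic_on {s. 0 < Re s}" and pos: "\<And>s. 0 < Re s \<Longrightarrow> 0 \<le> Re (G s)"
    and x: "0 < Re x" and y: "0 < Re y"
  shows "Re x * Re y * (cmod (G x + cnj (G y)))\<^sup>2 \<le> Re (G x) * Re (G y) * (cmod (x + cnj y))\<^sup>2"
proof -
  define C where "C = (\<lambda>a::complex. (a - 1) / (a + 1))"
  have ne: "a + 1 \<noteq> 0" if "0 \<le> Re a" for a :: complex
    using that by (auto simp: complex_eq_iff)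
  have C1: "1 - (cmod (C a))\<^sup>2 = 4 * Re a / (cmod (a + 1))\<^sup>2" if "0 \<le> Re a" for a
  proof -
    have "(cmod (a + 1))\<^sup>2 - (cmod (a - 1))\<^sup>2 = 4 * Re a"
      unfolding cmod_power2 by (simp add: power2_eq_square algebra_simps)
    then show ?thesis
      using ne[OF that] unfolding C_def norm_divide power_divide by (simp add: diff_divide_eq_iff)
  qed
  have C2: "1 - C a * cnj (C b) = 2 * (a + cnj b) / ((a + 1) * cnj (b + 1))"
    if "0 \<le> Re a" "0 \<le> Re b" for a b
    using ne[OF that(1)] ne[OF that(2)] ne[of "cnj b"] that unfolding C_def
    by (simp add: divide_simps) (simp add: algebra_simps)
  define X where "X = (\<lambda>z. (y + cnj y * z) / (1 - z))"
  have X: "0 < Re (X z)" if "z \<in> ball 0 1" for z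
  proof -
    have "z \<noteq> 1" using that by auto
    then have "Re (X z) = Re y * (1 - (cmod z)\<^sup>2) / (cmod (1 - z))\<^sup>2"
      unfolding X_def by (simp add: Re_divide cmod_power2 field_simps) (simp add: power2_eq_square algebra_simps)
    moreover have "(cmod z)\<^sup>2 < 1" using that by (simp add: power_less_one_iff abs_square_less_1)
    ultimately show ?thesis using y \<open>z \<noteq> 1\<close> by simp
  qed
  define f where "f = (\<lambda>z. C (G (X z)))"
  have "(\<lambda>z. G (X z)) holomorphic_on ball 0 1"
    using X by (intro holomorphic_on_compose_gen[OF _ hol, unfolded o_def]) (auto simp: X_def intro!: holomorphic_intros)
  then have fhol: "f holomorphic_on ball 0 1"
    unfolding f_def C_def using ne pos X by (intro holomorphic_intros) auto
  have fbd: "cmod (f z) \<le> 1" if "z \<in> ball 0 1" for z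
  proof -
    have "0 \<le> 1 - (cmod (f z))\<^sup>2" using pos X[OF that] by (simp add: f_def C1)
    then show ?thesis by (simp add: abs_square_le_1)
  qed
  have xy: "x + cnj y \<noteq> 0" using x y by (auto simp: complex_eq_iff)
  define z where "z = (x - y) / (x + cnj y)"
  have "1 - (cmod z)\<^sup>2 = 4 * Re x * Re y / (cmod (x + cnj y))\<^sup>2"
  proof -
    have "(cmod (x + cnj y))\<^sup>2 - (cmod (x - y))\<^sup>2 = 4 * Re x * Re y"
      unfolding cmod_power2 by (simp add: power2_eq_square algebra_simps)
    then show ?thesis
      using xy unfolding z_def norm_divide power_divide by (simp add: diff_divide_eq_iff)
  qed
  moreover from this have "cmod z < 1"
    using x y xy abs_square_less_1[of "cmod z"] zero_less_divide_iff by (smt (verit) abs_norm_cancel mult_pos_pos zero_less_norm_iff zero_less_power)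
  moreover have "X z = x"
  proof -
    have "1 - z = (y + cnj y) / (x + cnj y)" "y + cnj y * z = x * (y + cnj y) / (x + cnj y)"
      using xy by (simp_all add: z_def divide_simps) (simp_all add: algebra_simps)
    moreover have "y + cnj y \<noteq> 0" using y by (auto simp: complex_eq_iff)
    ultimately show ?thesis using xy by (simp add: X_def)
  qed
  moreover have "X 0 = y" by (simp add: X_def)
  ultimately have "4 * Re x * Re y / (cmod (x + cnj y))\<^sup>2 * (cmod (2 * (G x + cnj (G y)) / ((G x + 1) * cnj (G y + 1))))\<^sup>2
     \<le> (4 * Re (G x) / (cmod (G x + 1))\<^sup>2) * (4 * Re (G y) / (cmod (G y + 1))\<^sup>2)"
    using Schwarz_Pick_origin[OF fhol fbd, of z] x y pos by (simp add: f_def C1 C2)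
  moreover have "0 < cmod (G x + 1)" "0 < cmod (G y + 1)" "0 < cmod (x + cnj y)"
    using ne pos x y xy by auto
  moreover have "cmod (cnj (G y) + 1) = cmod (G y + 1)"
    by (metis complex_cnj_add complex_cnj_one complex_mod_cnj)
  moreover have "cmod (2 * (G x + cnj (G y))) = 2 * cmod (G x + cnj (G y))"
    by (simp only: norm_mult) simp
  ultimately show ?thesis
    unfolding norm_divide
    by (simp add: norm_mult power_divide power_mult_distrib divide_simps mult_ac del: distrib_left_numeral distrib_right_numeral)
qed

text \<open>
  The maximum principle, read off from Schwarz-Pick: the right-hand side vanishes if \<open>|f m| = 1\<close>.
\<close>

lemma schur_class_unimodular_value:
  fixes f :: "complex ^ 'd \<Rightarrow> complex"
  assumes f: "f \<in> schur_class" and m: "m \<in> polydisc" and w: "cmod (f m) = 1" and l: "l \<in> polydisc"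
  shows "f l = f m"
proof -
  obtain j where j: "(1 - (cmod (l $ j))\<^sup>2) * (1 - (cmod (m $ j))\<^sup>2) * (cmod (1 - f l * cnj (f m)))\<^sup>2 \<le> 0"
    using Schwarz_Pick_polydisc[OF f l m] w by auto
  have "cmod (l $ j) < 1" "cmod (m $ j) < 1" using l m by (auto simp: polydisc_def)
  then have "0 < (1 - (cmod (l $ j))\<^sup>2) * (1 - (cmod (m $ j))\<^sup>2)" by (simp add: abs_square_less_1)
  then have "(cmod (1 - f l * cnj (f m)))\<^sup>2 \<le> 0" using j by (meson mult_pos_pos not_le)
  then have "1 - f l * cnj (f m) = 0" by simp
  then have "f l * (cnj (f m) * f m) = f m" by (simp add: algebra_simps)
  moreover have "cnj (f m) * f m = 1" using w complex_norm_square[of "f m"] by (simp add: mult.commute)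
  ultimately show ?thesis by (simp only: mult_1_right)
qed

section \<open>The Julia inequality at a carapoint\<close>

lemma norm_nth_le_norm_inf: "cmod (z $ j) \<le> norm_inf z"
  unfolding norm_inf_def by (rule Max_ge) auto

lemma norm_inf_attained: "\<exists>j. norm_inf z = cmod (z $ j)"
proof -
  have "norm_inf z \<in> range (\<lambda>j. cmod (z $ j))" unfolding norm_inf_def by (rule Max_in) auto
  then show ?thesis by auto
qed

lemma norm_inf_le_norm: "norm_inf z \<le> norm z"
proof -
  obtain j where "norm_inf z = cmod (z $ j)" using norm_inf_attained by blast
  then show ?thesis using Finite_Cartesian_Product.norm_nth_le[of z j] by simp
qed

lemma norm_inf_less_1: "z \<in> polydisc \<Longrightarrow> norm_inf z < 1"
  using norm_inf_attained[of z] by (auto simp: polydisc_def)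

text \<open>
  A finite lower limit provides points of the polydisc tending to \<open>\<tau>\<close> along which the quotient stays bounded, and
  compactness of the closed disc makes the values converge; the limit is unimodular because the denominators
  tend to zero.  The bound is passed on in squared form and for each coordinate, the form in which it meets the
  factors in the Schwarz-Pick inequality.
\<close>

lemma carapoint_sequence:
  fixes f :: "complex ^ 'd \<Rightarrow> complex"
  assumes f: "f \<in> schur_class" and cara: "carapoint f \<tau>" and tau: "\<tau> \<in> torus"
  obtains X w \<alpha> where "\<And>n. X n \<in> polydisc" "X \<longlonglongrightarrow> \<tau>" "(\<lambda>n. f (X n)) \<longlonglongrightarrow> w"
    "cmod w = 1" "0 < \<alpha>" "\<And>n j. 1 - (cmod (f (X n)))\<^sup>2 \<le> \<alpha> * (1 - (cmod (X n $ j))\<^sup>2)"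
proof -
  let ?q = "\<lambda>z. ereal ((1 - cmod (f z)) / (1 - norm_inf z))"
  have "Liminf (at \<tau> within polydisc) ?q \<noteq> \<infinity>" using cara by (simp add: carapoint_def)
  then obtain C where C: "Liminf (at \<tau> within polydisc) ?q < ereal (real C)"
    by (auto simp: less_PInf_Ex_of_nat)
  then have "\<not> ereal (real C) \<le> Liminf (at \<tau> within polydisc) ?q" by simp
  then obtain y where y: "y < ereal (real C)" "\<not> (\<forall>\<^sub>F z in at \<tau> within polydisc. y < ?q z)"
    unfolding le_Liminf_iff by blast
  have "\<exists>z\<in>polydisc. dist z \<tau> < inverse (Suc n) \<and> ?q z \<le> C" for n
  proof (rule ccontr)
    assume neg: "\<not> ?thesis"
    have "\<forall>\<^sub>F z in at \<tau> within polydisc. y < ?q z"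
      unfolding eventually_at
    proof (intro exI[of _ "inverse (Suc n)"] conjI ballI impI)
      fix z assume z: "z \<in> polydisc" "z \<noteq> \<tau> \<and> dist z \<tau> < inverse (Suc n)"
      then have "\<not> ?q z \<le> C" using neg by blast
      then show "y < ?q z" using y(1) by (meson less_trans not_le)
    qed simp
    with y(2) show False by simp
  qed
  then obtain Z where Z: "\<And>n. Z n \<in> polydisc" "\<And>n. dist (Z n) \<tau> < inverse (Suc n)" "\<And>n. ?q (Z n) \<le> C"
    by metis
  have Zlim: "Z \<longlonglongrightarrow> \<tau>"
    unfolding tendsto_dist_iff[of Z]
    by (rule tendsto_sandwich[OF _ _ tendsto_const LIMSEQ_inverse_real_of_nat])
      (use Z(2) less_imp_le in \<open>auto intro!: always_eventually\<close>)
  have bd: "cmod (f (Z n)) \<le> 1" for n using f Z(1) by (auto simp: schur_class_def)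
  have "seq_compact (cball (0::complex) 1)" by (intro compact_imp_seq_compact) auto
  then obtain w r where r: "w \<in> cball 0 1" "strict_mono r" "((\<lambda>n. f (Z n)) \<circ> r) \<longlonglongrightarrow> w"
    by (rule seq_compactE[of _ "\<lambda>n. f (Z n)"]) (simp add: bd)
  \<comment> \<open>The summand 1 keeps the constant positive if \<open>C = 0\<close>.\<close>
  have est: "1 - (cmod (f (Z n)))\<^sup>2 \<le> (2 * C + 1) * (1 - (cmod (Z n $ j))\<^sup>2)" for n j
  proof -
    have pos: "0 < 1 - norm_inf (Z n)" using norm_inf_less_1[OF Z(1)] by simp
    have lt: "cmod (Z n $ j) < 1" using Z(1) by (auto simp: polydisc_def)
    have "1 - (cmod (f (Z n)))\<^sup>2 = (1 - cmod (f (Z n))) * (1 + cmod (f (Z n)))"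
      by (simp add: power2_eq_square algebra_simps)
    also have "\<dots> \<le> (1 - cmod (f (Z n))) * 2" using bd[of n] by (intro mult_left_mono) auto
    also have "\<dots> \<le> (C * (1 - norm_inf (Z n))) * 2"
      using Z(3)[of n] pos by (simp add: divide_le_eq)
    also have "\<dots> \<le> 2 * C * (1 - cmod (Z n $ j))"
      using norm_nth_le_norm_inf[of "Z n" j] by (simp add: mult_left_mono)
    also have "\<dots> \<le> (2 * C + 1) * (1 - cmod (Z n $ j))"
      using lt by (intro mult_right_mono) auto
    also have "\<dots> \<le> (2 * C + 1) * (1 - (cmod (Z n $ j))\<^sup>2)"
      using lt by (intro mult_left_mono) (auto simp: power2_eq_square mult_left_le)
    finally show ?thesis .
  qed
  have XL: "(Z \<circ> r) \<longlonglongrightarrow> \<tau>" by (rule LIMSEQ_subseq_LIMSEQ[OF Zlim r(2)])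
  have "1 \<le> cmod w"
  proof -
    fix j :: 'd
    have lim1: "(\<lambda>n. (2 * C + 1) * (1 - (cmod ((Z \<circ> r) n $ j))\<^sup>2)) \<longlonglongrightarrow> (2 * C + 1) * (1 - (cmod (\<tau> $ j))\<^sup>2)"
      by (intro tendsto_intros XL)
    have lim2: "(\<lambda>n. 1 - (cmod (((\<lambda>n. f (Z n)) \<circ> r) n))\<^sup>2) \<longlonglongrightarrow> 1 - (cmod w)\<^sup>2"
      by (intro tendsto_intros r)
    have "1 - (cmod w)\<^sup>2 \<le> (2 * C + 1) * (1 - (cmod (\<tau> $ j))\<^sup>2)"
      by (rule LIMSEQ_le[OF lim2 lim1]) (use est in auto)
    then have "1 \<le> (cmod w)\<^sup>2" using tau by (simp add: torus_def)
    then show ?thesis using abs_square_less_1[of "cmod w"] by simp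
  qed
  then have w: "cmod w = 1" using r(1) by simp
  show thesis
    by (rule that[of "Z \<circ> r" w "2 * C + 1"]) (use XL r(3) w est Z(1) in \<open>auto simp: o_def\<close>)
qed

text \<open>
  A point of the torus, a unimodular number and a constant for which the Julia inequality holds.  In
  one variable it says that \<open>f\<close> maps each horodisc at \<open>\<tau>\<close> into a horodisc at \<open>w\<close>.
\<close>

locale julia_point =
  fixes f :: "complex ^ 'd \<Rightarrow> complex" and \<tau> :: "complex ^ 'd" and w :: complex and \<alpha> :: real
  assumes schur: "f \<in> schur_class" and torus: "\<tau> \<in> torus"
    and norm_w: "cmod w = 1" and \<alpha>_pos: "0 < \<alpha>"
    and julia: "l \<in> polydisc \<Longrightarrow> \<exists>j. (1 - (cmod (l $ j))\<^sup>2) * (cmod (1 - f l * cnj w))\<^sup>2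
     \<le> \<alpha> * (1 - (cmod (f l))\<^sup>2) * (cmod (1 - l $ j * cnj (\<tau> $ j)))\<^sup>2"

text \<open>
  Apply Schwarz-Pick to \<open>l\<close> and a sequence along which the carapoint quotient stays bounded: the bound
  replaces \<open>1 - |f (X n)|\<^sup>2\<close> by a multiple of the factor \<open>1 - |X n $ j|\<^sup>2\<close> of the other side, which
  then cancels, and the rest is continuous in the limit.  The good coordinate may change with \<open>n\<close>; as there
  are finitely many, it suffices to refute that every coordinate fails in the limit.
\<close>

theorem carapoint_imp_julia_point:
  fixes f :: "complex ^ 'd \<Rightarrow> complex"
  assumes f: "f \<in> schur_class" and cara: "carapoint f \<tau>" and tau: "\<tau> \<in> torus"
  obtains w \<alpha> where "julia_point f \<tau> w \<alpha>"
proof -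
  obtain X w \<alpha> where X: "\<And>n. X n \<in> polydisc" "X \<longlonglongrightarrow> \<tau>" and w: "(\<lambda>n. f (X n)) \<longlonglongrightarrow> w"
    and w1: "cmod w = 1" and \<alpha>: "0 < \<alpha>"
    and est: "\<And>n j. 1 - (cmod (f (X n)))\<^sup>2 \<le> \<alpha> * (1 - (cmod (X n $ j))\<^sup>2)"
    using carapoint_sequence[OF f cara tau] by blast
  have "\<exists>j. (1 - (cmod (l $ j))\<^sup>2) * (cmod (1 - f l * cnj w))\<^sup>2
     \<le> \<alpha> * (1 - (cmod (f l))\<^sup>2) * (cmod (1 - l $ j * cnj (\<tau> $ j)))\<^sup>2"
    if l: "l \<in> polydisc" for l
  proof (rule ccontr)
    define \<Phi> where "\<Phi> = (\<lambda>j m v. (1 - (cmod (l $ j))\<^sup>2) * (cmod (1 - f l * cnj v))\<^sup>2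
       - \<alpha> * (1 - (cmod (f l))\<^sup>2) * (cmod (1 - l $ j * cnj (m $ j)))\<^sup>2)"
    assume "\<nexists>j. (1 - (cmod (l $ j))\<^sup>2) * (cmod (1 - f l * cnj w))\<^sup>2
       \<le> \<alpha> * (1 - (cmod (f l))\<^sup>2) * (cmod (1 - l $ j * cnj (\<tau> $ j)))\<^sup>2"
    then have pos: "0 < \<Phi> j \<tau> w" for j by (auto simp: \<Phi>_def not_le)
    have "(\<lambda>n. \<Phi> j (X n) (f (X n))) \<longlonglongrightarrow> \<Phi> j \<tau> w" for j
      unfolding \<Phi>_def by (intro tendsto_intros X w)
    then have "\<forall>\<^sub>F n in sequentially. 0 < \<Phi> j (X n) (f (X n))" for j
      using pos order_tendstoD(1) by blast
    then have "\<forall>\<^sub>F n in sequentially. \<forall>j. 0 < \<Phi> j (X n) (f (X n))"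
      by (rule eventually_all_finite)
    then obtain n where n: "\<And>j. 0 < \<Phi> j (X n) (f (X n))"
      using eventually_happens sequentially_bot by blast
    obtain j where j: "(1 - (cmod (l $ j))\<^sup>2) * (1 - (cmod (X n $ j))\<^sup>2) * (cmod (1 - f l * cnj (f (X n))))\<^sup>2
       \<le> (1 - (cmod (f l))\<^sup>2) * (1 - (cmod (f (X n)))\<^sup>2) * (cmod (1 - l $ j * cnj (X n $ j)))\<^sup>2"
      using Schwarz_Pick_polydisc[OF f l X(1)] by blast
    have "cmod (f l) \<le> 1" using f l by (simp add: schur_class_def)
    then have "0 \<le> 1 - (cmod (f l))\<^sup>2" by (simp add: abs_square_le_1)
    then have "(1 - (cmod (f l))\<^sup>2) * (1 - (cmod (f (X n)))\<^sup>2) * (cmod (1 - l $ j * cnj (X n $ j)))\<^sup>2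
        \<le> (1 - (cmod (f l))\<^sup>2) * (\<alpha> * (1 - (cmod (X n $ j))\<^sup>2)) * (cmod (1 - l $ j * cnj (X n $ j)))\<^sup>2"
      by (intro mult_right_mono mult_left_mono est) auto
    with j have "(1 - (cmod (X n $ j))\<^sup>2) * \<Phi> j (X n) (f (X n)) \<le> 0"
      by (simp add: \<Phi>_def algebra_simps)
    moreover have "cmod (X n $ j) < 1" using X(1) by (auto simp: polydisc_def)
    then have "0 < 1 - (cmod (X n $ j))\<^sup>2" by (simp add: abs_square_less_1)
    ultimately show False using n[of j] by (simp add: mult_le_0_iff)
  qed
  with f tau w1 \<alpha> show thesis by (intro that[of w \<alpha>]) (simp add: julia_point_def)
qed

text \<open>
  The hypothesis turns the Julia inequality into \<open>D\<^sup>2 \<le> \<alpha> K (1 - |f l|\<^sup>2)\<close> for \<open>D = |f l - w|\<close>, and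
  \<open>1 - |f l|\<^sup>2 \<le> 2 D\<close> because \<open>w\<close> is unimodular.  The point is that the bound is linear in \<open>K\<close>: along a segment
  that approaches \<open>\<tau>\<close> non-tangentially \<open>K\<close> can be taken proportional to the distance from \<open>\<tau>\<close>.
\<close>

lemma (in julia_point) dist_boundary_value_le:
  assumes l: "l \<in> polydisc"
    and K: "\<And>j. (cmod (l $ j - \<tau> $ j))\<^sup>2 \<le> K * (1 - (cmod (l $ j))\<^sup>2)"
  shows "cmod (f l - w) \<le> 2 * \<alpha> * K"
proof -
  have rot: "cmod (1 - a * cnj b) = cmod (a - b)" if "cmod b = 1" for a b
  proof -
    have "1 - a * cnj b = (b - a) * cnj b"
      using that by (simp add: left_diff_distrib complex_norm_square[symmetric])
    then have "cmod (1 - a * cnj b) = cmod (b - a) * cmod b" by (simp only: norm_mult complex_mod_cnj)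
    then show ?thesis using that by (simp add: norm_minus_commute)
  qed
  define D where "D = cmod (f l - w)"
  obtain j where j: "(1 - (cmod (l $ j))\<^sup>2) * (cmod (1 - f l * cnj w))\<^sup>2
     \<le> \<alpha> * (1 - (cmod (f l))\<^sup>2) * (cmod (1 - l $ j * cnj (\<tau> $ j)))\<^sup>2"
    using julia[OF l] by blast
  define p where "p = 1 - (cmod (l $ j))\<^sup>2"
  have "cmod (l $ j) < 1" using l by (auto simp: polydisc_def)
  then have p: "0 < p" by (simp add: p_def abs_square_less_1)
  have "0 \<le> K * p" using K[of j] by (simp add: p_def) (rule order_trans[OF zero_le_power2])
  then have K0: "0 \<le> K" using p by (simp add: zero_le_mult_iff)
  have fl: "cmod (f l) \<le> 1" using schur l by (simp add: schur_class_def)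
  have "1 - cmod (f l) \<le> D" using norm_triangle_ineq2[of w "f l"] norm_w by (simp add: D_def norm_minus_commute)
  then have "(1 - cmod (f l)) * (1 + cmod (f l)) \<le> D * 2"
    using fl by (intro mult_mono) (auto simp: D_def)
  then have fD: "1 - (cmod (f l))\<^sup>2 \<le> 2 * D" by (simp add: power2_eq_square algebra_simps)
  have "p * D\<^sup>2 \<le> \<alpha> * (1 - (cmod (f l))\<^sup>2) * (cmod (l $ j - \<tau> $ j))\<^sup>2"
    using j torus norm_w by (simp add: rot p_def D_def torus_def)
  also have "\<dots> \<le> \<alpha> * (2 * D) * (K * p)"
    using fD K[of j] \<alpha>_pos fl by (intro mult_mono) (auto simp: p_def D_def abs_square_le_1)
  finally have "p * D\<^sup>2 \<le> p * (2 * \<alpha> * K * D)" by (simp add: algebra_simps)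
  then have "D * D \<le> (2 * \<alpha> * K) * D" using p by (simp add: power2_eq_square)
  then have "D \<le> 2 * \<alpha> * K"
    using K0 \<alpha>_pos by (cases "D = 0") (auto simp: D_def)
  then show ?thesis by (simp add: D_def)
qed

text \<open>
  On a set approaching non-tangentially with constant \<open>c\<close> the preceding bound applies with
  \<open>K = c |z - \<tau>|\<close>, so \<open>w\<close> is a non-tangential limit.  It is the only one because the radius ending at \<open>\<tau>\<close> is
  such a set.
\<close>

lemma (in julia_point) boundary_value_eq: "boundary_value f \<tau> = w"
proof -
  have lim: "has_nontangential_limit f \<tau> w"
    unfolding has_nontangential_limit_def
  proof (intro allI impI)
    fix S assume "approaches_nontangentially S \<tau>"
    then obtain c where S: "S \<subseteq> polydisc" and c: "c > 0" "\<And>z. z \<in> S \<Longrightarrow> norm_inf (z - \<tau>) \<le> c * (1 - norm_inf z)"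
      unfolding approaches_nontangentially_def by blast
    have est: "cmod (f z - w) \<le> 2 * \<alpha> * (c * norm (z - \<tau>))" if z: "z \<in> S" for z
    proof (rule dist_boundary_value_le)
      show zp: "z \<in> polydisc" using z S by auto
      fix j
      have lt: "cmod (z $ j) < 1" using zp by (auto simp: polydisc_def)
      have a: "cmod (z $ j - \<tau> $ j) \<le> norm_inf (z - \<tau>)"
        using norm_nth_le_norm_inf[of "z - \<tau>" j] by simp
      have "norm_inf (z - \<tau>) \<le> c * (1 - norm_inf z)" by (rule c(2)[OF z])
      also have "\<dots> \<le> c * (1 - cmod (z $ j))" using norm_nth_le_norm_inf[of z j] c by simp
      also have "\<dots> \<le> c * (1 - (cmod (z $ j))\<^sup>2)"
        using c lt by (intro mult_left_mono) (auto simp: power2_eq_square mult_left_le)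
      finally have "cmod (z $ j - \<tau> $ j) * cmod (z $ j - \<tau> $ j) \<le> norm (z - \<tau>) * (c * (1 - (cmod (z $ j))\<^sup>2))"
        using a norm_inf_le_norm[of "z - \<tau>"] by (intro mult_mono) auto
      then show "(cmod (z $ j - \<tau> $ j))\<^sup>2 \<le> c * norm (z - \<tau>) * (1 - (cmod (z $ j))\<^sup>2)"
        by (simp add: power2_eq_square mult_ac)
    qed
    have "((\<lambda>z. 2 * \<alpha> * (c * norm (z - \<tau>))) \<longlongrightarrow> 2 * \<alpha> * (c * norm (\<tau> - \<tau>))) (at \<tau> within S)"
      by (intro tendsto_intros)
    then have "((\<lambda>z. 2 * \<alpha> * (c * norm (z - \<tau>))) \<longlongrightarrow> 0) (at \<tau> within S)" by simp
    then have "((\<lambda>z. f z - w) \<longlongrightarrow> 0) (at \<tau> within S)"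
      by (rule Lim_null_comparison[rotated]) (use est in \<open>auto simp: eventually_at_filter\<close>)
    then show "(f \<longlongrightarrow> w) (at \<tau> within S)" by (rule LIM_zero_cancel)
  qed
  define S where "S = (\<lambda>t. (1 - t) *\<^sub>R \<tau>) ` {0<..<1::real}"
  have tj: "cmod (\<tau> $ j) = 1" for j using torus by (simp add: torus_def)
  have ninf: "norm_inf (t *\<^sub>R \<tau>) = \<bar>t\<bar>" for t :: real
    using norm_inf_attained[of "t *\<^sub>R \<tau>"] tj by auto
  have radial: "filterlim (\<lambda>t. (1 - t) *\<^sub>R \<tau>) (at \<tau> within S) (at_right (0::real))"
    unfolding filterlim_at
  proof
    have "((\<lambda>t::real. (1 - t) *\<^sub>R \<tau>) \<longlongrightarrow> (1 - 0) *\<^sub>R \<tau>) (at_right 0)" by (intro tendsto_intros)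
    then show "((\<lambda>t::real. (1 - t) *\<^sub>R \<tau>) \<longlongrightarrow> \<tau>) (at_right 0)" by simp
    have "\<tau> \<noteq> 0" using tj by force
    then have "(1 - t) *\<^sub>R \<tau> \<noteq> \<tau>" if "t > 0" for t
      using that scaleR_cancel_right[of "1 - t" \<tau> 1] by simp
    then show "\<forall>\<^sub>F t in at_right (0::real). (1 - t) *\<^sub>R \<tau> \<in> S \<and> (1 - t) *\<^sub>R \<tau> \<noteq> \<tau>"
      using eventually_at_right_real[OF zero_less_one] by (auto simp: S_def elim!: eventually_mono)
  qed
  then have nb: "at \<tau> within S \<noteq> bot"
    by (auto simp: filterlim_def filtermap_bot_iff bot_unique)
  have nt: "approaches_nontangentially S \<tau>"
    unfolding approaches_nontangentially_def
  proof (intro conjI exI[of _ 1] ballI)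
    show "S \<subseteq> polydisc" using tj by (auto simp: S_def polydisc_def)
    show "\<tau> \<in> closure S" using nb by (simp add: trivial_limit_within closure_def)
    fix z assume "z \<in> S"
    then obtain t where t: "0 < t" "t < 1" "z = (1 - t) *\<^sub>R \<tau>" by (auto simp: S_def)
    have "z - \<tau> = (- t) *\<^sub>R \<tau>" by (simp add: t algebra_simps)
    then show "norm_inf (z - \<tau>) \<le> 1 * (1 - norm_inf z)" using ninf[of "-t"] ninf[of "1-t"] t by simp
  qed simp
  show ?thesis
    unfolding boundary_value_def
  proof (rule the_equality)
    show "has_nontangential_limit f \<tau> w" by (fact lim)
    fix v assume "has_nontangential_limit f \<tau> v"
    then show "v = w"
      using lim nt tendsto_unique[OF nb] unfolding has_nontangential_limit_def by blast
  qed
qed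

section \<open>Two convergence theorems in one complex variable\<close>

text \<open>
  The limit is the infimum \<open>I\<close> of \<open>Re (G s) / Re s\<close>.  Subtracting \<open>I s\<close> keeps the real part nonnegative and
  makes the infimum zero, so some point \<open>y\<close> has \<open>Re (F y) \<le> \<epsilon> Re y\<close>.  Schwarz-Pick with base point \<open>y\<close> spreads
  this to all large \<open>x\<close>, and since it controls \<open>F x + cnj (F y)\<close> the imaginary part is controlled too.
\<close>

lemma half_plane_angular_derivative_at_infinity:
  assumes hol: "G holomorphic_on {s. 0 < Re s}" and pos: "\<And>s. 0 < Re s \<Longrightarrow> 0 \<le> Re (G s)"
  shows "\<exists>c. ((\<lambda>x::real. G (of_real x) / of_real x) \<longlongrightarrow> c) at_top"
proof -
  define I where "I = Inf ((\<lambda>s. Re (G s) / Re s) ` {s. 0 < Re s})"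
  have bdd: "bdd_below ((\<lambda>s. Re (G s) / Re s) ` {s. 0 < Re s})"
    using pos by (intro bdd_belowI[of _ 0]) auto
  have ne: "(\<lambda>s. Re (G s) / Re s) ` {s. 0 < Re s} \<noteq> {}"
    using zero_less_one by (auto intro!: exI[of _ 1])
  define F where "F = (\<lambda>s. G s - of_real I * s)"
  have Fpos: "0 \<le> Re (F s)" if "0 < Re s" for s
  proof -
    have "I \<le> Re (G s) / Re s" unfolding I_def using that by (intro cInf_lower bdd) auto
    then show ?thesis using that by (simp add: F_def le_divide_eq)
  qed
  have Fhol: "F holomorphic_on {s. 0 < Re s}"
    unfolding F_def by (intro holomorphic_intros hol)
  have "((\<lambda>x::real. F (of_real x) / of_real x) \<longlongrightarrow> 0) at_top"
  proof (rule tendstoI)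
    fix e :: real assume "e > 0"
    \<comment> \<open>The estimate below is \<open>4 \<epsilon> x\<close> from Schwarz-Pick plus \<open>\<epsilon> x\<close> for \<open>F y\<close>.\<close>
    define \<epsilon> where "\<epsilon> = e / 6"
    have \<epsilon>: "\<epsilon> > 0" using \<open>e > 0\<close> by (simp add: \<epsilon>_def)
    then obtain y where y: "0 < Re y" "Re (G y) / Re y < I + \<epsilon>"
      using cInf_lessD[OF ne, of "I + \<epsilon>"] by (auto simp: I_def)
    then have Fy: "Re (F y) \<le> \<epsilon> * Re y" by (simp add: F_def divide_less_eq algebra_simps)
    have "\<forall>\<^sub>F x::real in at_top. max 1 (max (cmod y) (cmod (F y) / \<epsilon>)) < x"
      by (rule eventually_gt_at_top)
    then show "\<forall>\<^sub>F x::real in at_top. dist (F (of_real x) / of_real x) 0 < e"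
    proof eventually_elim
      case (elim x)
      then have x: "1 < x" "cmod y < x" "cmod (F y) < \<epsilon> * x" using \<epsilon> by (auto simp: divide_less_eq mult.commute)
      define m where "m = cmod (F x + cnj (F y))"
      have Rem: "Re (F x) \<le> m"
        using complex_Re_le_cmod[of "F x + cnj (F y)"] Fpos[OF y(1)] by (simp add: m_def)
      have "cmod (x + cnj y) \<le> 2 * x"
        using norm_triangle_ineq[of "of_real x" "cnj y"] x by simp
      then have sq: "(cmod (x + cnj y))\<^sup>2 \<le> (2 * x)\<^sup>2" by (rule power_mono) simp
      have "x * Re y * m\<^sup>2 \<le> Re (F x) * Re (F y) * (cmod (x + cnj y))\<^sup>2"
        using Schwarz_Pick_half_plane[OF Fhol Fpos, of "of_real x" y] x y by (simp add: m_def)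
      also have "\<dots> \<le> m * (\<epsilon> * Re y) * (2 * x)\<^sup>2"
        using Rem Fy sq Fpos[of x] Fpos[OF y(1)] x \<epsilon> y by (intro mult_mono) (auto simp: m_def)
      finally have "(x * Re y) * (m * m) \<le> (x * Re y) * (4 * \<epsilon> * x * m)"
        by (simp add: power2_eq_square mult_ac)
      then have "m * m \<le> 4 * \<epsilon> * x * m" using x y by simp
      then have "m \<le> 4 * \<epsilon> * x" using x \<epsilon> by (cases "m = 0") (auto simp: m_def)
      moreover have "cmod (F x) \<le> m + cmod (F y)"
        using norm_triangle_ineq4[of "F x + cnj (F y)" "cnj (F y)"] by (simp add: m_def)
      ultimately have "cmod (F x) \<le> 5 * \<epsilon> * x" using x by (simp add: algebra_simps)
      also have "\<dots> < e * x" using x \<open>e > 0\<close> by (simp add: \<epsilon>_def)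
      finally show ?case using x by (simp add: norm_divide divide_less_eq)
    qed
  qed
  then have "((\<lambda>x::real. F (of_real x) / of_real x + of_real I) \<longlongrightarrow> 0 + of_real I) at_top"
    by (intro tendsto_intros)
  moreover have "\<forall>\<^sub>F x::real in at_top. F (of_real x) / of_real x + of_real I = G (of_real x) / of_real x"
    using eventually_gt_at_top[of "0::real"] by eventually_elim (simp add: F_def field_simps)
  ultimately have "((\<lambda>x::real. G (of_real x) / of_real x) \<longlongrightarrow> 0 + of_real I) at_top"
    by (rule Lim_transform_eventually)
  then show ?thesis by blast
qed

text \<open>
  By Montel every sequence of parameters tending to zero has a subsequence along which the functions
  converge to a holomorphic limit on \<open>U\<close>.  Any two such limits agree on \<open>A\<close>, hence on \<open>U\<close> by the identity
  theorem, and therefore the family itself converges.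
\<close>

lemma Vitali_at_right:
  fixes g :: "real \<Rightarrow> complex \<Rightarrow> complex"
  assumes U: "open U" "connected U" and t0: "0 < t0"
    and hol: "\<And>t. \<lbrakk>0 < t; t < t0\<rbrakk> \<Longrightarrow> g t holomorphic_on U"
    and bd: "\<And>t z. \<lbrakk>0 < t; t < t0; z \<in> U\<rbrakk> \<Longrightarrow> cmod (g t z) \<le> B"
    and A: "A \<subseteq> U" "\<xi> \<in> U" "\<xi> islimpt A"
    and lim: "\<And>z. z \<in> A \<Longrightarrow> \<exists>l. ((\<lambda>t. g t z) \<longlongrightarrow> l) (at_right 0)"
    and p: "p \<in> U"
  shows "\<exists>l. ((\<lambda>t. g t p) \<longlongrightarrow> l) (at_right 0)"
proof -
  obtain lm where lm: "\<And>z. z \<in> A \<Longrightarrow> ((\<lambda>t. g t z) \<longlongrightarrow> lm z) (at_right 0)" using lim by metis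
  have sub: "\<exists>h r. h holomorphic_on U \<and> strict_mono (r :: nat \<Rightarrow> nat) \<and> (\<lambda>n. g (X (r n)) p) \<longlonglongrightarrow> h p \<and> (\<forall>z\<in>A. h z = lm z)"
    if X: "\<And>n. 0 < X n" "\<And>n. X n < t0" "X \<longlonglongrightarrow> 0" for X
  proof -
    obtain h r where h: "h holomorphic_on U" "strict_mono (r :: nat \<Rightarrow> nat)"
        "\<And>z. z \<in> U \<Longrightarrow> (\<lambda>n. g (X (r n)) z) \<longlonglongrightarrow> h z"
    proof (rule Montel[of U "range (\<lambda>n. g (X n))" "\<lambda>n. g (X n)"])
      fix K assume "compact K" "K \<subseteq> U"
      then show "\<exists>B. \<forall>h\<in>range (\<lambda>n. g (X n)). \<forall>z\<in>K. cmod (h z) \<le> B"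
        using bd X by (intro exI[of _ B]) (auto simp: subset_iff)
    qed (use U hol X in auto)
    have "h z = lm z" if "z \<in> A" for z
    proof (rule LIMSEQ_unique)
      show "(\<lambda>n. g (X (r n)) z) \<longlonglongrightarrow> h z" using h(3) that A by auto
      have "(X \<circ> r) \<longlonglongrightarrow> 0" by (rule LIMSEQ_subseq_LIMSEQ[OF X(3) h(2)])
      then have "filterlim (\<lambda>n. X (r n)) (at_right 0) sequentially"
        using X(1) by (auto simp: filterlim_at o_def less_imp_neq[symmetric] intro!: always_eventually)
      with lm[OF that] show "(\<lambda>n. g (X (r n)) z) \<longlonglongrightarrow> lm z" by (rule filterlim_compose)
    qed
    then show ?thesis using h p by blast
  qed
  have X0: "(\<lambda>n. t0 / real (n + 2)) \<longlonglongrightarrow> 0"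
    using LIMSEQ_ignore_initial_segment[OF lim_const_over_n[of t0], of 2] by simp
  obtain h0 where h0: "h0 holomorphic_on U" "\<And>z. z \<in> A \<Longrightarrow> h0 z = lm z"
    using sub[OF _ _ X0] t0 by (auto simp: divide_less_eq)
  have "((\<lambda>t. g t p) \<longlongrightarrow> h0 p) (at_right 0)"
  proof (rule ccontr)
    assume "\<not> ?thesis"
    then obtain e where e: "e > 0" "\<not> (\<forall>\<^sub>F t in at_right 0. dist (g t p) (h0 p) < e)"
      by (auto simp: tendsto_iff)
    have "\<exists>t. 0 < t \<and> t < t0 / real (n + 2) \<and> e \<le> dist (g t p) (h0 p)" for n
    proof (rule ccontr)
      assume "\<not> ?thesis"
      then have "\<And>t. 0 < t \<Longrightarrow> t < t0 / real (n + 2) \<Longrightarrow> dist (g t p) (h0 p) < e" by (auto simp: not_le)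
      then have "\<forall>\<^sub>F t in at_right 0. dist (g t p) (h0 p) < e"
        unfolding eventually_at_right_field using t0 by (intro exI[of _ "t0 / real (n + 2)"]) auto
      with e(2) show False ..
    qed
    then obtain X where X: "\<And>n. 0 < X n" "\<And>n. X n < t0 / real (n + 2)" "\<And>n. e \<le> dist (g (X n) p) (h0 p)"
      by metis
    have "X n < t0" for n
    proof -
      have "t0 / real (n + 2) \<le> t0" using t0 by (simp add: divide_le_eq)
      then show ?thesis using X(2)[of n] by simp
    qed
    moreover have "X \<longlonglongrightarrow> 0"
      by (rule tendsto_sandwich[OF _ _ tendsto_const X0]) (use X(1,2) less_imp_le in \<open>auto intro!: always_eventually\<close>)
    ultimately obtain h r where h: "h holomorphic_on U" "strict_mono (r :: nat \<Rightarrow> nat)"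
      "(\<lambda>n. g (X (r n)) p) \<longlonglongrightarrow> h p" "\<And>z. z \<in> A \<Longrightarrow> h z = lm z"
      using sub X(1) by blast
    have "h p - h0 p = 0"
      by (rule analytic_continuation[of "\<lambda>z. h z - h0 z" U A \<xi>])
        (use h h0 U A p in \<open>auto intro!: holomorphic_intros\<close>)
    then have "(\<lambda>n. g (X (r n)) p) \<longlonglongrightarrow> h0 p" using h(3) by simp
    then have "\<forall>\<^sub>F n in sequentially. dist (g (X (r n)) p) (h0 p) < e" using e(1) by (rule tendstoD)
    then show False using X(3) eventually_happens[of _ sequentially] by (fastforce simp: not_less[symmetric])
  qed
  then show ?thesis ..
qed

section \<open>Directional derivatives\<close>

lemma finite_range_bounds:
  fixes z :: "'d::finite \<Rightarrow> complex"
  assumes "\<And>j. 0 < Re (z j)"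
  obtains \<mu> M where "0 < \<mu>" "0 < M" "\<And>j. \<mu> \<le> Re (z j)" "\<And>j. cmod (z j) \<le> M"
proof
  have "Min (range (\<lambda>j. Re (z j))) \<in> range (\<lambda>j. Re (z j))" by (rule Min_in) auto
  then show "0 < Min (range (\<lambda>j. Re (z j)))" using assms by auto
  show "Min (range (\<lambda>j. Re (z j))) \<le> Re (z j)" for j by (rule Min_le) auto
  show M: "cmod (z j) \<le> Max (range (\<lambda>j. cmod (z j)))" for j by (rule Max_ge) auto
  have "0 < cmod (z undefined)" using assms[of undefined] by auto
  then show "0 < Max (range (\<lambda>j. cmod (z j)))" using M less_le_trans by blast
qed

text \<open>
  The point reached from \<open>\<tau>\<close> after time \<open>t\<close> with velocity \<open>- \<tau> z\<close> in each coordinate.  In this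
  parametrization a direction points into the polydisc iff all \<open>Re (z j)\<close> are positive, whatever the point \<open>\<tau>\<close>
  of the torus is.
\<close>

definition inward :: "complex ^ 'd \<Rightarrow> ('d \<Rightarrow> complex) \<Rightarrow> real \<Rightarrow> complex ^ 'd" where
  "inward \<tau> z t = (\<chi> j. \<tau> $ j * (1 - of_real t * z j))"

text \<open>
  Here \<open>1 - |1 - t z j|\<^sup>2\<close> is at least \<open>t \<eta>\<close>, whereas the squared distance from \<open>\<tau>\<close> is at most \<open>t\<^sup>2 R\<^sup>2\<close>.  This
  bounds the difference quotients uniformly in \<open>z\<close> on sets where \<open>\<eta>\<close> and \<open>R\<close> can be kept fixed.
\<close>

lemma (in julia_point) inward_bounds:
  assumes \<eta>: "0 < \<eta>" "\<And>j. \<eta> \<le> Re (z j)" and R: "\<And>j. cmod (z j) \<le> R"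
    and t: "0 < t" "t * R\<^sup>2 \<le> \<eta>"
  shows "inward \<tau> z t \<in> polydisc" "cmod (f (inward \<tau> z t) - w) \<le> 2 * \<alpha> * (R\<^sup>2 / \<eta>) * t"
proof -
  have tj: "cmod (\<tau> $ j) = 1" for j using torus by (simp add: torus_def)
  have zR: "(cmod (z j))\<^sup>2 \<le> R\<^sup>2" for j using R[of j] by (intro power_mono) auto
  have dist: "t * \<eta> \<le> 1 - (cmod (inward \<tau> z t $ j))\<^sup>2" for j
  proof -
    have "(cmod (inward \<tau> z t $ j))\<^sup>2 = (cmod (1 - of_real t * z j))\<^sup>2"
      by (simp add: inward_def norm_mult tj)
    also have "\<dots> = 1 - 2 * t * Re (z j) + t * (t * (cmod (z j))\<^sup>2)"
      unfolding cmod_power2 by (simp add: power2_eq_square algebra_simps)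
    also have "\<dots> \<le> 1 - 2 * t * \<eta> + t * (t * R\<^sup>2)"
      using t \<eta>(2)[of j] zR[of j] by (intro add_mono diff_mono mult_left_mono) auto
    also have "\<dots> \<le> 1 - 2 * t * \<eta> + t * \<eta>"
      using t by (intro add_left_mono mult_left_mono) auto
    finally show ?thesis by (simp add: mult.commute)
  qed
  show disc: "inward \<tau> z t \<in> polydisc"
    unfolding polydisc_def
  proof (intro CollectI allI)
    fix j
    have "0 < 1 - (cmod (inward \<tau> z t $ j))\<^sup>2"
      using dist[of j] mult_pos_pos[OF t(1) \<eta>(1)] by linarith
    then show "cmod (inward \<tau> z t $ j) < 1" using abs_square_less_1[of "cmod (inward \<tau> z t $ j)"] by simp
  qed
  have "cmod (f (inward \<tau> z t) - w) \<le> 2 * \<alpha> * (t * R\<^sup>2 / \<eta>)"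
  proof (rule dist_boundary_value_le[OF disc])
    fix j
    have "inward \<tau> z t $ j - \<tau> $ j = - (\<tau> $ j * (of_real t * z j))"
      by (simp add: inward_def algebra_simps)
    then have "cmod (inward \<tau> z t $ j - \<tau> $ j) = t * cmod (z j)"
      using t by (simp add: norm_mult tj)
    then have "(cmod (inward \<tau> z t $ j - \<tau> $ j))\<^sup>2 = t\<^sup>2 * (cmod (z j))\<^sup>2"
      by (simp add: power_mult_distrib)
    also have "\<dots> \<le> t\<^sup>2 * R\<^sup>2" using zR by (intro mult_left_mono) auto
    also have "\<dots> = t * R\<^sup>2 / \<eta> * (t * \<eta>)" using \<eta>(1) by (simp add: power2_eq_square)
    also have "\<dots> \<le> t * R\<^sup>2 / \<eta> * (1 - (cmod (inward \<tau> z t $ j))\<^sup>2)"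
      using dist[of j] t \<eta>(1) by (intro mult_left_mono) auto
    finally show "(cmod (inward \<tau> z t $ j - \<tau> $ j))\<^sup>2 \<le> t * R\<^sup>2 / \<eta> * (1 - (cmod (inward \<tau> z t $ j))\<^sup>2)" .
  qed
  then show "cmod (f (inward \<tau> z t) - w) \<le> 2 * \<alpha> * (R\<^sup>2 / \<eta>) * t" by (simp add: mult_ac)
qed

text \<open>
  For a real direction all coordinates can be driven by one complex variable \<open>t\<close> in a disc tangent to the
  imaginary axis at 0, because each \<open>1 - a j t\<close> then traverses a disc tangent to the unit circle at 1.  The map
  \<open>t = 1 / (s + A)\<close> takes the right half-plane onto such a disc.  There \<open>G s = 1 / (1 - f cnj w)\<close> has nonnegative
  real part, unless \<open>f\<close> takes the value \<open>w\<close> and so is constant by the maximum principle.  Hence \<open>G s / s\<close> has a limit \<open>c\<close> at infinity, and the difference quotient tends to \<open>- w / c\<close>.  That \<open>c\<close> does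
  not vanish follows from the linear bound of \<open>inward_bounds\<close>.
\<close>

lemma (in julia_point) real_directional_derivative:
  fixes a :: "'d \<Rightarrow> real"
  assumes a: "\<And>j. 0 < a j"
  shows "\<exists>L. ((\<lambda>t. (f (inward \<tau> (\<lambda>j. of_real (a j)) t) - w) / of_real t) \<longlongrightarrow> L) (at_right 0)"
proof -
  define pt where "pt = inward \<tau> (\<lambda>j. complex_of_real (a j))"
  have tj: "cmod (\<tau> $ j) = 1" for j using torus by (simp add: torus_def)
  have ww: "w * cnj w = 1" using norm_w by (simp add: complex_norm_square[symmetric])
  obtain \<mu> M where M: "0 < \<mu>" "0 < M" "\<And>j. \<mu> \<le> a j" "\<And>j. \<bar>a j\<bar> \<le> M"
    using finite_range_bounds[of "\<lambda>j. complex_of_real (a j)"] a by auto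
  have bounds: "pt t \<in> polydisc" "cmod (f (pt t) - w) \<le> 2 * \<alpha> * (M\<^sup>2 / \<mu>) * t"
    if "0 < t" "t < \<mu> / M\<^sup>2" for t
    using inward_bounds[of \<mu> "\<lambda>j. complex_of_real (a j)" M t] M that
    by (auto simp: pt_def less_divide_eq)
  have small: "\<forall>\<^sub>F t in at_right 0. t \<in> {0<..<\<mu> / M\<^sup>2}"
    using M by (intro eventually_at_right_real) simp
  show ?thesis
  proof (cases "\<exists>m\<in>polydisc. f m = w")
    case True
    then have const: "f l = w" if "l \<in> polydisc" for l
      using schur_class_unimodular_value[OF schur _ _ that] norm_w by metis
    have "\<forall>\<^sub>F t in at_right 0. (f (pt t) - w) / of_real t = 0"
      using small by eventually_elim (use bounds const in auto)
    then have "((\<lambda>t. (f (pt t) - w) / of_real t) \<longlongrightarrow> 0) (at_right 0)" by (rule tendsto_eventually)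
    then show ?thesis unfolding pt_def by blast
  next
    case False
    \<comment> \<open>Any \<open>A\<close> with \<open>a j < 2 * A\<close> for all \<open>j\<close> keeps \<open>1 - a j / (s + A)\<close> inside the disc.\<close>
    define A where "A = (\<Sum>j\<in>UNIV. a j)"
    have aA: "a j \<le> A" for j unfolding A_def using a by (intro member_le_sum) (auto intro: less_imp_le)
    have A0: "0 < A" using a[of undefined] aA[of undefined] by linarith
    have smallA: "\<forall>\<^sub>F t in at_right 0. t \<in> {0<..<1 / A}"
      using A0 by (intro eventually_at_right_real) simp
    define \<gamma> where "\<gamma> = (\<lambda>s. \<chi> j. \<tau> $ j * (1 - of_real (a j) / (s + of_real A)))"
    define G where "G = (\<lambda>s. 1 / (1 - f (\<gamma> s) * cnj w))"
    have nz: "s + of_real A \<noteq> 0" if "0 < Re s" for s using that A0 by (auto simp: complex_eq_iff)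
    have disc: "\<gamma> s \<in> polydisc" if s: "0 < Re s" for s
      unfolding polydisc_def
    proof (intro CollectI allI)
      fix j
      let ?u = "s + of_real A"
      have "a j * a j < a j * (2 * Re ?u)"
        using s aA[of j] a[of j] by (intro mult_strict_left_mono) auto
      then have "(cmod (?u - of_real (a j)))\<^sup>2 < (cmod ?u)\<^sup>2"
        unfolding cmod_power2 by (simp add: power2_eq_square algebra_simps)
      then have "cmod (?u - of_real (a j)) < cmod ?u" by (rule power_less_imp_less_base) simp
      moreover have "1 - of_real (a j) / ?u = (?u - of_real (a j)) / ?u" using nz[OF s] by (simp add: diff_divide_distrib)
      ultimately show "cmod (\<gamma> s $ j) < 1"
        using nz[OF s] by (simp add: \<gamma>_def norm_mult tj norm_divide)
    qed
    have p: "1 - f (\<gamma> s) * cnj w \<noteq> 0" if "0 < Re s" for s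
    proof
      assume "1 - f (\<gamma> s) * cnj w = 0"
      then have "f (\<gamma> s) * (w * cnj w) = w" by (simp add: algebra_simps)
      then have "f (\<gamma> s) = w" using ww by simp
      then show False using False disc[OF that] by blast
    qed
    have "(\<lambda>s. f (\<gamma> s)) holomorphic_on {s. 0 < Re s}"
    proof (rule analytic_in_compose_holomorphic)
      show "analytic_in f polydisc" using schur by (simp add: schur_class_def)
      show "open {s. 0 < Re s}" by (simp add: open_halfspace_Re_gt)
      show "(\<lambda>s. \<gamma> s $ j) holomorphic_on {s. 0 < Re s}" for j
        unfolding \<gamma>_def vec_lambda_beta using nz by (intro holomorphic_intros) auto
    qed (use disc in auto)
    then have "G holomorphic_on {s. 0 < Re s}"
      unfolding G_def using p by (intro holomorphic_intros) auto
    moreover have "0 \<le> Re (G s)" if "0 < Re s" for s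
    proof -
      have "cmod (f (\<gamma> s) * cnj w) \<le> 1"
        using schur disc[OF that] norm_w by (simp add: schur_class_def norm_mult)
      then have "0 \<le> Re (1 - f (\<gamma> s) * cnj w)"
        using complex_Re_le_cmod[of "f (\<gamma> s) * cnj w"] by (simp del: times_complex.sel)
      then show ?thesis by (simp add: G_def Re_divide del: times_complex.sel minus_complex.sel)
    qed
    ultimately obtain c where c: "((\<lambda>x::real. G (of_real x) / of_real x) \<longlongrightarrow> c) at_top"
      using half_plane_angular_derivative_at_infinity by blast
    have "filterlim (\<lambda>t::real. - A + inverse t) at_top (at_right 0)"
      by (intro filterlim_tendsto_add_at_top[OF tendsto_const] filterlim_inverse_at_top_right)
    from filterlim_compose[OF c this]
    have "((\<lambda>t::real. G (of_real (- A + inverse t)) / of_real (- A + inverse t) * (1 - of_real A * of_real t)) \<longlongrightarrow> c * (1 - of_real A * of_real 0)) (at_right 0)"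
      by (intro tendsto_intros)
    moreover have "\<forall>\<^sub>F t in at_right 0. G (of_real (- A + inverse t)) / of_real (- A + inverse t) * (1 - of_real A * of_real t)
        = of_real t / (1 - f (pt t) * cnj w)"
      using smallA
    proof eventually_elim
      case (elim t)
      then have t: "0 < t" "A * t < 1" using A0 by (auto simp: less_divide_eq mult.commute)
      define x where "x = - A + inverse t"
      have xt: "x * t = 1 - A * t" using t by (simp add: x_def left_diff_distrib)
      then have "x \<noteq> 0" using t by auto
      have "\<gamma> (of_real x) = pt t"
        by (simp add: \<gamma>_def pt_def inward_def x_def vec_eq_iff divide_inverse mult.commute)
      moreover have "1 - complex_of_real A * of_real t = of_real x * of_real t"
        using arg_cong[OF xt, of complex_of_real] by simp
      ultimately show ?case
        using \<open>x \<noteq> 0\<close> unfolding x_def[symmetric] by (simp add: G_def)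
    qed
    ultimately have H: "((\<lambda>t. of_real t / (1 - f (pt t) * cnj w)) \<longlongrightarrow> c) (at_right 0)"
      using Lim_transform_eventually by fastforce
    define K where "K = 2 * \<alpha> * (M\<^sup>2 / \<mu>)"
    have K: "0 < K" using M \<alpha>_pos by (simp add: K_def)
    have "1 / K \<le> cmod c"
    proof (rule tendsto_lowerbound[OF tendsto_norm[OF H]])
      show "\<forall>\<^sub>F t in at_right 0. 1 / K \<le> cmod (of_real t / (1 - f (pt t) * cnj w))"
        using small
      proof eventually_elim
        case (elim t)
        have "1 - f (pt t) * cnj w = (w - f (pt t)) * cnj w" using ww by (simp add: algebra_simps)
        then have "cmod (1 - f (pt t) * cnj w) = cmod (f (pt t) - w)"
          using norm_w by (simp add: norm_mult norm_minus_commute)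
        moreover have "cmod (f (pt t) - w) \<le> K * t" using bounds elim by (simp add: K_def)
        moreover have "f (pt t) \<noteq> w" using False bounds(1)[of t] elim by auto
        ultimately show ?case using K elim by (simp add: norm_divide field_simps)
      qed
    qed simp
    then have "c \<noteq> 0" using K by (auto simp: divide_le_0_iff)
    then have "((\<lambda>t. - w * inverse (of_real t / (1 - f (pt t) * cnj w))) \<longlongrightarrow> - w * inverse c) (at_right 0)"
      by (intro tendsto_intros H)
    moreover have "- w * inverse (of_real t / (1 - f (pt t) * cnj w)) = (f (pt t) - w) / of_real t" for t
    proof -
      have "- w * (1 - f (pt t) * cnj w) = f (pt t) * (w * cnj w) - w" by (simp add: algebra_simps)
      then have "- w * (1 - f (pt t) * cnj w) = f (pt t) - w" using ww by simp
      then show ?thesis by (simp only: inverse_divide times_divide_eq_right)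
    qed
    ultimately show ?thesis unfolding pt_def by auto
  qed
qed

text \<open>
  In general no analytic disc in the polydisc is tangent to \<open>z\<close>, but \<open>z\<close> is the value at \<open>\<zeta> = \<i>\<close> of the family
  \<open>v \<zeta> = Re z + \<zeta> Im z\<close>, which is real for real \<open>\<zeta>\<close>.  The difference quotients are holomorphic and uniformly
  bounded in \<open>\<zeta>\<close> on a rectangle containing 0 and \<open>\<i>\<close>, and they converge on its real part, so the Vitali
  argument carries convergence to \<open>\<i>\<close>.
\<close>

lemma (in julia_point) complex_directional_derivative:
  fixes z :: "'d \<Rightarrow> complex"
  assumes z: "\<And>j. 0 < Re (z j)"
  shows "\<exists>L. ((\<lambda>t. (f (inward \<tau> z t) - w) / of_real t) \<longlongrightarrow> L) (at_right 0)"
proof -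
  obtain \<mu> M where M: "0 < \<mu>" "0 < M" "\<And>j. \<mu> \<le> Re (z j)" "\<And>j. cmod (z j) \<le> M"
    using finite_range_bounds[of z] z by metis
  \<comment> \<open>The rectangle is so narrow that \<open>v \<zeta>\<close> still points inwards.\<close>
  define \<epsilon> where "\<epsilon> = min 1 (\<mu> / (2 * M))"
  have \<epsilon>: "0 < \<epsilon>" "\<epsilon> \<le> 1" "\<epsilon> * M \<le> \<mu> / 2"
    using M by (auto simp: \<epsilon>_def min_def field_simps)
  define v where "v = (\<lambda>\<zeta> j. complex_of_real (Re (z j)) + \<zeta> * of_real (Im (z j)))"
  define U where "U = box (Complex (-\<epsilon>) (-2)) (Complex \<epsilon> 2)"
  have vRe: "\<mu> / 2 \<le> Re (v \<zeta> j)" and vbd: "cmod (v \<zeta> j) \<le> 4 * M" if "\<zeta> \<in> U" for \<zeta> j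
  proof -
    have \<zeta>: "\<bar>Re \<zeta>\<bar> \<le> \<epsilon>" "\<bar>Im \<zeta>\<bar> \<le> 2" using that by (auto simp: U_def in_box_complex_iff)
    have im: "\<bar>Im (z j)\<bar> \<le> M" and re: "\<bar>Re (z j)\<bar> \<le> M"
      using M(4)[of j] abs_Im_le_cmod[of "z j"] abs_Re_le_cmod[of "z j"] by linarith+
    have "\<bar>Re \<zeta> * Im (z j)\<bar> \<le> \<epsilon> * M" unfolding abs_mult using \<zeta> im \<epsilon> by (intro mult_mono) auto
    then show "\<mu> / 2 \<le> Re (v \<zeta> j)" using M(3)[of j] \<epsilon>(3) by (simp add: v_def)
    have "cmod \<zeta> \<le> 3" using cmod_le[of \<zeta>] \<zeta> \<epsilon>(2) by linarith
    then have "cmod (\<zeta> * of_real (Im (z j))) \<le> 3 * M"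
      unfolding norm_mult norm_of_real using im by (intro mult_mono) auto
    then show "cmod (v \<zeta> j) \<le> 4 * M"
      unfolding v_def using re by (intro order_trans[OF norm_triangle_ineq]) simp
  qed
  define t0 where "t0 = (\<mu> / 2) / (4 * M)\<^sup>2"
  have t0: "0 < t0" using M by (simp add: t0_def)
  have bounds: "inward \<tau> (v \<zeta>) t \<in> polydisc"
    "cmod (f (inward \<tau> (v \<zeta>) t) - w) \<le> 2 * \<alpha> * ((4 * M)\<^sup>2 / (\<mu> / 2)) * t"
    if "0 < t" "t < t0" "\<zeta> \<in> U" for t \<zeta>
  proof -
    have "t * (4 * M)\<^sup>2 \<le> \<mu> / 2"
      using that(2) M by (simp add: t0_def less_divide_eq del: power_mult_distrib)
    then show "inward \<tau> (v \<zeta>) t \<in> polydisc"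
      "cmod (f (inward \<tau> (v \<zeta>) t) - w) \<le> 2 * \<alpha> * ((4 * M)\<^sup>2 / (\<mu> / 2)) * t"
      using inward_bounds[of "\<mu> / 2" "v \<zeta>" "4 * M" t] vRe vbd that M by auto
  qed
  have "\<exists>L. ((\<lambda>t. (f (inward \<tau> (v \<i>) t) - w) / of_real t) \<longlongrightarrow> L) (at_right 0)"
  proof (rule Vitali_at_right[where U = U and g = "\<lambda>t \<zeta>. (f (inward \<tau> (v \<zeta>) t) - w) / of_real t"
        and A = "of_real ` {-\<epsilon><..<\<epsilon>}" and \<xi> = 0])
    show "open U" "connected U" unfolding U_def by (auto intro: convex_connected)
    show "0 < t0" by (fact t0)
    fix t assume t: "0 < t" "t < t0"
    have "(\<lambda>\<zeta>. f (inward \<tau> (v \<zeta>) t)) holomorphic_on U"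
    proof (rule analytic_in_compose_holomorphic)
      show "analytic_in f polydisc" using schur by (simp add: schur_class_def)
      show "(\<lambda>\<zeta>. inward \<tau> (v \<zeta>) t $ j) holomorphic_on U" for j
        unfolding inward_def v_def vec_lambda_beta by (intro holomorphic_intros)
    qed (use bounds t in \<open>auto simp: U_def\<close>)
    then show "(\<lambda>\<zeta>. (f (inward \<tau> (v \<zeta>) t) - w) / of_real t) holomorphic_on U"
      using t by (intro holomorphic_intros) auto
    fix \<zeta> assume "\<zeta> \<in> U"
    then show "cmod ((f (inward \<tau> (v \<zeta>) t) - w) / of_real t) \<le> 2 * \<alpha> * ((4 * M)\<^sup>2 / (\<mu> / 2))"
      using bounds(2)[OF t] t by (simp add: norm_divide divide_le_eq)
  next
    show AU: "of_real ` {-\<epsilon><..<\<epsilon>} \<subseteq> U" "0 \<in> U" "\<i> \<in> U"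
      using \<epsilon> by (auto simp: U_def in_box_complex_iff)
    show "(0::complex) islimpt of_real ` {-\<epsilon><..<\<epsilon>}"
      unfolding islimpt_approachable
    proof (intro allI impI)
      fix e :: real assume "0 < e"
      then show "\<exists>x'\<in>complex_of_real ` {-\<epsilon><..<\<epsilon>}. x' \<noteq> 0 \<and> dist x' 0 < e"
        using \<epsilon> by (intro bexI[OF _ imageI[of "min e \<epsilon> / 2"]]) (auto simp: norm_divide)
    qed
    fix \<zeta> :: complex assume "\<zeta> \<in> of_real ` {-\<epsilon><..<\<epsilon>}"
    then obtain x where x: "\<zeta> = of_real x" "x \<in> {-\<epsilon><..<\<epsilon>}" by auto
    have v: "v \<zeta> = (\<lambda>j. of_real (Re (z j) + x * Im (z j)))" by (simp add: v_def x)
    have "0 < Re (z j) + x * Im (z j)" for j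
    proof -
      have "\<zeta> \<in> U" using x AU by auto
      from vRe[OF this, of j] show ?thesis using M by (simp add: v)
    qed
    then show "\<exists>l. ((\<lambda>t. (f (inward \<tau> (v \<zeta>) t) - w) / of_real t) \<longlongrightarrow> l) (at_right 0)"
      unfolding v by (rule real_directional_derivative)
  qed
  moreover have "v \<i> = z" by (auto simp: v_def complex_eq_iff)
  ultimately show ?thesis by simp
qed

theorem theorem1p14:
  fixes \<phi> :: "complex ^ 'd \<Rightarrow> complex" and \<tau> :: "complex ^ 'd"
  assumes "\<phi> \<in> schur_agler TYPE('i)"
    and "\<tau> \<in> torus"
    and "carapoint \<phi> \<tau>"
  shows "directionally_differentiable \<phi> \<tau>"
proof -
  have \<phi>: "\<phi> \<in> schur_class"
    using assms(1) schur_agler_norm_le_1[OF assms(1)] by (simp add: schur_class_def schur_agler_def)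
  obtain w \<alpha> where "julia_point \<phi> \<tau> w \<alpha>"
    using carapoint_imp_julia_point[OF \<phi> assms(3,2)] .
  then interpret julia_point \<phi> \<tau> w \<alpha> .
  show ?thesis
    unfolding directionally_differentiable_def
  proof (intro allI impI)
    fix \<delta> assume \<delta>: "- \<delta> \<in> half_plane_product \<tau>"
    define z where "z = (\<lambda>j. - (\<delta> $ j) * cnj (\<tau> $ j))"
    have z: "0 < Re (z j)" for j
      using \<delta> unfolding half_plane_product_def z_def by simp
    have "\<tau> $ j * cnj (\<tau> $ j) = 1" for j
      using assms(2) by (simp add: torus_def complex_norm_square[symmetric])
    then have "\<tau> $ j * (t * z j) = - (t * \<delta> $ j)" for t :: complex and j
      by (simp add: z_def)
    then have "\<tau> + t *\<^sub>R \<delta> = inward \<tau> z t" for t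
      by (simp add: inward_def vec_eq_iff right_diff_distrib scaleR_conv_of_real[where 'a = complex])
    then show "\<exists>L. ((\<lambda>t. (\<phi> (\<tau> + t *\<^sub>R \<delta>) - boundary_value \<phi> \<tau>) / complex_of_real t) \<longlongrightarrow> L) (at_right 0)"
      using complex_directional_derivative[OF z] by (simp add: boundary_value_eq)
  qed
qed

end
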